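(* Let $\mathbb{K}$ be a field, let $q=p^r$ be a prime power with $p$ prime, and let $\mathcal{C}$ be an $[n,k]$ code over $\mathbb{F}_q$ with parity check matrix $H\in\mathbb{F}_q^{(n-k)\times n}$. Let $\mathcal{G}$ be the reduced Gröbner basis of the ideal $I_{\Lambda(H_{+,e})}\subset\mathbb{K}[\mathbf{x},\mathbf{y}]$ with respect to any monomial order. Then the Graver basis of the generalized code ideal $I_+(\mathcal{C})\subset\mathbb{K}[\mathbf{x}]$ is, up to sign of its elements, $$\mathrm{Gr}_+(\mathcal{C})=\left\{\mathbf{x}^u-\mathbf{x}^v\mid\mathbf{x}^u\mathbf{y}^v-\mathbf{x}^v\mathbf{y}^u\in\mathcal{G}\right\}.$$
   Context: Binomials and Graver bases. Here a binomial is $\mathbf{x}^u-\mathbf{x}^v$ with $\mathbf{x}^u\ne\mathbf{x}^v$ relatively prime monomials (pure binomial). A binomial $\mathbf{x}^u-\mathbf{x}^v$ in an ideal $I$ is primitive if there is no other binomial $\mathbf{x}^{u'}-\mathbf{x}^{v'}$ in $I$ such that $\mathbf{x}^{u'}$ divides $\mathbf{x}^u$ and $\mathbf{x}^{v'}$ divides $\mathbf{x}^v$. The Graver basis of $I$ is the set of primitive binomials of $I$; "up to sign" means that a primitive binomial $f$ is identified with $-f$. $\mathrm{Gr}_+(\mathcal{C})$ denotes the Graver basis of $I_+(\mathcal{C})$. Codes. An $[n,k]$ code over $\mathbb{F}_q$ is a $k$-dimensional linear subspace $\mathcal{C}\subseteq\mathbb{F}_q^n$ (words are row vectors). A parity check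 matrix is an $(n-k)\times n$ matrix $H$ over $\mathbb{F}_q$ such that $c\in\mathcal{C}$ if and only if $cH^T=0$. Toric ideal. For an integer matrix $A$ with $N$ columns, the toric ideal of $A$ in a polynomial ring over $\mathbb{K}$ in $N$ variables $t_1,\dots,t_N$ is $I_A=\langle t^u-t^v\mid Au=Av,\ u,v\in\mathbb{N}_0^N\rangle$. Generalized code ideal. Fix a primitive element $\alpha$ of $\mathbb{F}_q$. The crossing map $\blacktriangle:\mathbb{F}_q^n\to\mathbb{Z}^{n(q-1)}$ sends $(a_1,\dots,a_n)$ to the concatenation of $n$ blocks of length $q-1$, where the $i$th block is the unit vector $\mathbf{e}_j$ if $a_i=\alpha^j$ with $1\le j\le q-1$, and the zero vector if $a_i=0$. In $\mathbb{K}[\mathbf{x}]=\mathbb{K}[x_{11},\dots,x_{n,q-1}]$ (variables $x_{ij}$, $1\le i\le n$, $1\le j\le q-1$), $I_+(\mathcal{C})=\langle\mathbf{x}^{\blacktriangle a}-\mathbf{x}^{\blacktriangle b}\mid a,b\in\mathbb{F}_q^n,\ a-b\in\mathcal{C}\rangle+I_q$, where $I_q$ is the ideal generated by $\bigcup_{i=1}^n\left(\{x_{iu}x_{iv}-x_{iw}\mid\alpha^u+\alpha^v=\alpha^w\}\cup\{x_{iu}x_{iv}-1\mid\alpha^u+\alpha^v=0\}\right)$ with $u,v,w\in\{1,\dots,q-1\}$ ($u=v$ allowed). The ideal $I_{\Lambda(H_{+,e})}$. Fix an $\mathbb{F}_p$-basis $\{b_1,\dots,b_r\}$ of $\mathbb{F}_q$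 and let $\pi_s:\mathbb{F}_q\to\mathbb{F}_p$, $\sum_j a_jb_j\mapsto a_s$. Let $m=n-k$ and $H=(h_{ij})$. Let $H_{+,e}\in\mathbb{F}_p^{mr\times n(q-1)}$ be the matrix with rows indexed by $(i,s)$, $1\le i\le m$, $1\le s\le r$, and columns indexed by $(j,\ell)$, $1\le j\le n$, $1\le\ell\le q-1$ (both ordered lexicographically), with entry $\pi_s(\alpha^\ell h_{ij})$ at $((i,s),(j,\ell))$. Let $\triangle H_{+,e}$ be any integer matrix of the same size reducing to $H_{+,e}$ modulo $p$. Its $p$-Lawrence lifting is $$\Lambda(H_{+,e})_p=\begin{pmatrix}\triangle H_{+,e}&\mathbf{0}&pI_{mr}\\ I_{n(q-1)}&I_{n(q-1)}&\mathbf{0}\end{pmatrix}$$ with identity blocks $I_{mr},I_{n(q-1)}$. Let $I_{\Lambda(H_{+,e})_p}$ be its toric ideal in $\mathbb{K}[\mathbf{x},\mathbf{y},\mathbf{z}]$, where $\mathbf{x}=(x_{11},\dots,x_{n,q-1})$, $\mathbf{y}=(y_{11},\dots,y_{n,q-1})$ and $\mathbf{z}=(z_1,\dots,z_{mr})$ correspond to the three column blocks, and define $I_{\Lambda(H_{+,e})}=\{g(\mathbf{x},\mathbf{y},\mathbf{1})\mid g\in I_{\Lambda(H_{+,e})_p}\}\subset\mathbb{K}[\mathbf{x},\mathbf{y}]$. *)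

theory Defs
  imports "HOL-Library.Poly_Mapping" "HOL-Library.Cardinality" "HOL-Algebra.Ideal" "HOL-Computational_Algebra.Primes"
    "Jordan_Normal_Form.VS_Connect"
begin

section \<open>Polynomial rings\<close>

text \<open>
  A polynomial with coefficients in \<open>'k\<close> and variables in \<open>'v\<close> is a finitely supported map
  from exponent vectors to coefficients.  The polynomial ring in the variables of a set \<open>V\<close>
  is an explicit carrier in this type, so that the number of variables may depend on
  parameters and ideals are ideals of that ring.
\<close>

type_synonym ('v, 'k) mpoly = "('v \<Rightarrow>\<^sub>0 nat) \<Rightarrow>\<^sub>0 'k"

definition monomials :: "'v set \<Rightarrow> ('v \<Rightarrow>\<^sub>0 nat) set" where
  "monomials V = {t. Poly_Mapping.keys t \<subseteq> V}"

definition mpoly_ring :: "'v set \<Rightarrow> ('v, 'k::comm_ring_1) mpoly ring" where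
  "mpoly_ring V = \<lparr>carrier = {f. Poly_Mapping.keys f \<subseteq> monomials V},
     mult = (*), one = 1, zero = 0, add = (+)\<rparr>"

definition mon :: "('v \<Rightarrow>\<^sub>0 nat) \<Rightarrow> ('v, 'k::comm_ring_1) mpoly" where
  "mon t = Poly_Mapping.single t 1"

definition pvar :: "'v \<Rightarrow> ('v, 'k::comm_ring_1) mpoly" where
  "pvar v = mon (Poly_Mapping.single v 1)"

definition psubst ::
  "('v \<Rightarrow> ('w, 'k::comm_ring_1) mpoly) \<Rightarrow> ('v, 'k) mpoly \<Rightarrow> ('w, 'k) mpoly" where
  "psubst \<phi> f = (\<Sum>t\<in>Poly_Mapping.keys f. Poly_Mapping.single 0 (Poly_Mapping.lookup f t) *
     (\<Prod>v\<in>Poly_Mapping.keys t. \<phi> v ^ Poly_Mapping.lookup t v))"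


section \<open>Reduced Groebner bases\<close>

text \<open>A monomial order is a set of pairs \<open>(s, t)\<close> of exponent vectors with \<open>s \<le> t\<close>.\<close>

definition monomial_order :: "'v set \<Rightarrow> ('v \<Rightarrow>\<^sub>0 nat) rel \<Rightarrow> bool" where
  "monomial_order V R \<longleftrightarrow> well_order_on (monomials V) R \<and>
     (\<forall>s t w. (s, t) \<in> R \<longrightarrow> w \<in> monomials V \<longrightarrow> (s + w, t + w) \<in> R)"

text \<open>Exponent vector of the leading monomial; meaningful for nonzero polynomials only.\<close>

definition lead_exp :: "('v \<Rightarrow>\<^sub>0 nat) rel \<Rightarrow> ('v, 'k::comm_ring_1) mpoly \<Rightarrow> ('v \<Rightarrow>\<^sub>0 nat)" where
  "lead_exp R f = (THE t. t \<in> Poly_Mapping.keys f \<and> (\<forall>s\<in>Poly_Mapping.keys f. (s, t) \<in> R))"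

definition initial_ideal ::
  "'v set \<Rightarrow> ('v \<Rightarrow>\<^sub>0 nat) rel \<Rightarrow> ('v, 'k::comm_ring_1) mpoly set \<Rightarrow> ('v, 'k) mpoly set" where
  "initial_ideal V R F = genideal (mpoly_ring V) {mon (lead_exp R f) | f. f \<in> F \<and> f \<noteq> 0}"

definition groebner_basis ::
  "'v set \<Rightarrow> ('v \<Rightarrow>\<^sub>0 nat) rel \<Rightarrow> ('v, 'k::comm_ring_1) mpoly set \<Rightarrow> ('v, 'k) mpoly set \<Rightarrow> bool" where
  "groebner_basis V R I G \<longleftrightarrow>
     finite G \<and> G \<subseteq> I \<and> initial_ideal V R G = initial_ideal V R I"

definition reduced_groebner_basis ::
  "'v set \<Rightarrow> ('v \<Rightarrow>\<^sub>0 nat) rel \<Rightarrow> ('v, 'k::comm_ring_1) mpoly set \<Rightarrow> ('v, 'k) mpoly set \<Rightarrow> bool" where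
  "reduced_groebner_basis V R I G \<longleftrightarrow> groebner_basis V R I G \<and>
     (\<forall>g\<in>G. g \<noteq> 0 \<and> Poly_Mapping.lookup g (lead_exp R g) = 1) \<and>
     (\<forall>g\<in>G. \<forall>h\<in>G. h \<noteq> g \<longrightarrow> (\<forall>t\<in>Poly_Mapping.keys g.
        \<not> (mon (lead_exp R h) :: ('v, 'k) mpoly) dvd mon t))"


section \<open>Graver bases and toric ideals\<close>

text \<open>
  A pair \<open>(u, v)\<close> is pure if \<open>x\<^sup>u - x\<^sup>v\<close> is a pure binomial: the monomials are distinct and
  have no common monomial divisor other than 1.
\<close>

definition pure_pair :: "'k::field itself \<Rightarrow> ('v \<Rightarrow>\<^sub>0 nat) \<Rightarrow> ('v \<Rightarrow>\<^sub>0 nat) \<Rightarrow> bool" where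
  "pure_pair K u v \<longleftrightarrow> (mon u :: ('v, 'k) mpoly) \<noteq> mon v \<and>
     (\<forall>w. (mon w :: ('v, 'k) mpoly) dvd mon u \<longrightarrow> (mon w :: ('v, 'k) mpoly) dvd mon v \<longrightarrow>
        (mon w :: ('v, 'k) mpoly) = 1)"

definition graver_basis :: "('v, 'k::field) mpoly set \<Rightarrow> ('v, 'k) mpoly set" where
  "graver_basis I = {mon u - mon v | u v.
     pure_pair TYPE('k) u v \<and> (mon u - mon v :: ('v, 'k) mpoly) \<in> I \<and>
     \<not> (\<exists>u' v'. pure_pair TYPE('k) u' v' \<and> (mon u' - mon v' :: ('v, 'k) mpoly) \<in> I \<and>
          (mon u' - mon v' :: ('v, 'k) mpoly) \<noteq> mon u - mon v \<and>
          (mon u' :: ('v, 'k) mpoly) dvd mon u \<and> (mon v' :: ('v, 'k) mpoly) dvd mon v)}"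

text \<open>The classes of the elements of \<open>F\<close> when \<open>f\<close> is identified with \<open>-f\<close>.\<close>

definition up_to_sign :: "'a::uminus set \<Rightarrow> 'a set set" where
  "up_to_sign F = (\<lambda>f. {f, - f}) ` F"

text \<open>The columns of the integer matrix \<open>A\<close> are indexed by the variables \<open>V\<close>, its rows by \<open>M\<close>.\<close>

definition toric_ideal ::
  "'i set \<Rightarrow> 'v set \<Rightarrow> ('i \<Rightarrow> 'v \<Rightarrow> int) \<Rightarrow> ('v, 'k::field) mpoly set" where
  "toric_ideal M V A = genideal (mpoly_ring V) {mon u - mon v | u v.
     u \<in> monomials V \<and> v \<in> monomials V \<and>
     (\<forall>i\<in>M. (\<Sum>c\<in>V. A i c * int (Poly_Mapping.lookup u c)) =
             (\<Sum>c\<in>V. A i c * int (Poly_Mapping.lookup v c)))}"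


section \<open>Linear codes\<close>

definition linear_code :: "nat \<Rightarrow> nat \<Rightarrow> 'f::field vec set \<Rightarrow> bool" where
  "linear_code n k C \<longleftrightarrow> VectorSpace.subspace class_ring C (module_vec TYPE('f) n) \<and>
     vectorspace.dim class_ring ((module_vec TYPE('f) n)\<lparr>carrier := C\<rparr>) = k"

definition parity_check_matrix :: "nat \<Rightarrow> nat \<Rightarrow> 'f::field vec set \<Rightarrow> 'f mat \<Rightarrow> bool" where
  "parity_check_matrix n k C H \<longleftrightarrow> H \<in> carrier_mat (n - k) n \<and>
     (\<forall>c\<in>carrier_vec n. c \<in> C \<longleftrightarrow> mat_of_row c * transpose_mat H = 0\<^sub>m 1 (n - k))"

definition primitive_element :: "'f::{field, finite} \<Rightarrow> bool" where
  "primitive_element \<alpha> \<longleftrightarrow> range (\<lambda>j::nat. \<alpha> ^ j) = UNIV - {0}"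


section \<open>The generalized code ideal\<close>

text \<open>
  The variables \<open>x\<^sub>i\<^sub>j\<close>, \<open>y\<^sub>i\<^sub>j\<close>, \<open>z\<^sub>i\<^sub>s\<close>.  Coordinates \<open>i\<close> of words, rows of \<open>H\<close> and basis indices
  \<open>s\<close> are counted from 0, as in the matrix library; powers \<open>j\<close> of the primitive element run
  through \<open>1, \<dots>, q - 1\<close>.
\<close>

datatype var = X "nat \<times> nat" | Y "nat \<times> nat" | Z "nat \<times> nat"

definition block_idx :: "'f::{field, finite} itself \<Rightarrow> nat \<Rightarrow> (nat \<times> nat) set" where
  "block_idx F n = {..<n} \<times> {1..CARD('f) - 1}"

definition rename_exp :: "('a \<Rightarrow> 'v) \<Rightarrow> ('a \<Rightarrow>\<^sub>0 nat) \<Rightarrow> ('v \<Rightarrow>\<^sub>0 nat)" where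
  "rename_exp \<phi> u = (\<Sum>i\<in>Poly_Mapping.keys u. Poly_Mapping.single (\<phi> i) (Poly_Mapping.lookup u i))"

definition xpow :: "(nat \<times> nat \<Rightarrow>\<^sub>0 nat) \<Rightarrow> (var, 'k::field) mpoly" where
  "xpow u = mon (rename_exp X u)"

definition ypow :: "(nat \<times> nat \<Rightarrow>\<^sub>0 nat) \<Rightarrow> (var, 'k::field) mpoly" where
  "ypow u = mon (rename_exp Y u)"

definition crossing :: "'f::{field, finite} \<Rightarrow> 'f vec \<Rightarrow> (nat \<times> nat \<Rightarrow>\<^sub>0 nat)" where
  "crossing \<alpha> a =
     (\<Sum>(i, j)\<in>{(i, j) \<in> block_idx TYPE('f) (dim_vec a). a $ i = \<alpha> ^ j}. Poly_Mapping.single (i, j) 1)"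

definition I_q :: "'f::{field, finite} \<Rightarrow> nat \<Rightarrow> (var, 'k::field) mpoly set" where
  "I_q \<alpha> n = genideal (mpoly_ring (X ` block_idx TYPE('f) n))
     (\<Union>i<n. {pvar (X (i, u)) * pvar (X (i, v)) - pvar (X (i, w)) | u v w.
               u \<in> {1..CARD('f) - 1} \<and> v \<in> {1..CARD('f) - 1} \<and> w \<in> {1..CARD('f) - 1} \<and>
               \<alpha> ^ u + \<alpha> ^ v = \<alpha> ^ w} \<union>
             {pvar (X (i, u)) * pvar (X (i, v)) - 1 | u v.
               u \<in> {1..CARD('f) - 1} \<and> v \<in> {1..CARD('f) - 1} \<and> \<alpha> ^ u + \<alpha> ^ v = 0})"

definition I_plus :: "'f::{field, finite} \<Rightarrow> nat \<Rightarrow> 'f vec set \<Rightarrow> (var, 'k::field) mpoly set" where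
  "I_plus \<alpha> n C = set_add (mpoly_ring (X ` block_idx TYPE('f) n))
     (genideal (mpoly_ring (X ` block_idx TYPE('f) n))
       {xpow (crossing \<alpha> a) - xpow (crossing \<alpha> b) | a b.
          a \<in> carrier_vec n \<and> b \<in> carrier_vec n \<and> a - b \<in> C})
     (I_q \<alpha> n)"


section \<open>The Lawrence-type ideal\<close>

text \<open>The prime field \<open>F\<^sub>p\<close> inside \<open>F\<^sub>q\<close>; reduction of integers modulo \<open>p\<close> is then \<^const>\<open>of_int\<close>.\<close>

definition prime_subfield :: "'f::ring_1 set" where
  "prime_subfield = range of_int"

definition prime_field_basis :: "nat \<Rightarrow> (nat \<Rightarrow> 'f::field) \<Rightarrow> bool" where
  "prime_field_basis r b \<longleftrightarrow>
     (\<forall>c. (\<forall>s<r. c s \<in> prime_subfield) \<longrightarrow> (\<Sum>s<r. c s * b s) = 0 \<longrightarrow> (\<forall>s<r. c s = 0)) \<and>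
     (\<forall>x. \<exists>c. (\<forall>s<r. c s \<in> prime_subfield) \<and> x = (\<Sum>s<r. c s * b s))"

definition coord :: "nat \<Rightarrow> (nat \<Rightarrow> 'f::field) \<Rightarrow> nat \<Rightarrow> 'f \<Rightarrow> 'f" where
  "coord r b s x = (THE a. \<exists>c. (\<forall>t<r. c t \<in> prime_subfield) \<and> x = (\<Sum>t<r. c t * b t) \<and> a = c s)"

definition H_plus_e ::
  "'f::{field, finite} \<Rightarrow> nat \<Rightarrow> (nat \<Rightarrow> 'f) \<Rightarrow> 'f mat \<Rightarrow> nat \<times> nat \<Rightarrow> nat \<times> nat \<Rightarrow> 'f" where
  "H_plus_e \<alpha> r b H = (\<lambda>(i, s) (j, l). coord r b s (\<alpha> ^ l * H $$ (i, j)))"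

definition integer_lift ::
  "'i set \<Rightarrow> 'c set \<Rightarrow> ('i \<Rightarrow> 'c \<Rightarrow> 'f::ring_1) \<Rightarrow> ('i \<Rightarrow> 'c \<Rightarrow> int) \<Rightarrow> bool" where
  "integer_lift M N A D \<longleftrightarrow> (\<forall>i\<in>M. \<forall>c\<in>N. of_int (D i c) = A i c)"

text \<open>
  The \<open>p\<close>-Lawrence lifting of \<open>D\<close>: upper block rows are indexed by \<open>Inl\<close>, lower ones by \<open>Inr\<close>,
  and the three column blocks by the variables \<open>x\<close>, \<open>y\<close>, \<open>z\<close>.
\<close>

fun lawrence_lifting ::
  "nat \<Rightarrow> (nat \<times> nat \<Rightarrow> nat \<times> nat \<Rightarrow> int) \<Rightarrow> (nat \<times> nat) + (nat \<times> nat) \<Rightarrow> var \<Rightarrow> int" where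
  "lawrence_lifting p D (Inl i) (X c) = D i c"
| "lawrence_lifting p D (Inl i) (Y c) = 0"
| "lawrence_lifting p D (Inl i) (Z i') = (if i = i' then int p else 0)"
| "lawrence_lifting p D (Inr d) (X c) = (if d = c then 1 else 0)"
| "lawrence_lifting p D (Inr d) (Y c) = (if d = c then 1 else 0)"
| "lawrence_lifting p D (Inr d) (Z i') = 0"

text \<open>
  Toric ideal of the \<open>p\<close>-Lawrence lifting of an integer matrix \<open>D\<close> with rows \<open>M\<close> and
  columns \<open>N\<close>, and its image under \<open>z \<mapsto> 1\<close>.
\<close>

definition lawrence_toric_ideal ::
  "nat \<Rightarrow> (nat \<times> nat) set \<Rightarrow> (nat \<times> nat) set \<Rightarrow> (nat \<times> nat \<Rightarrow> nat \<times> nat \<Rightarrow> int) \<Rightarrow>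
   (var, 'k::field) mpoly set" where
  "lawrence_toric_ideal p M N D =
     toric_ideal (Inl ` M \<union> Inr ` N) (X ` N \<union> Y ` N \<union> Z ` M) (lawrence_lifting p D)"

definition z_to_one :: "var \<Rightarrow> (var, 'k::field) mpoly" where
  "z_to_one v = (case v of Z _ \<Rightarrow> 1 | _ \<Rightarrow> pvar v)"

definition I_Lambda ::
  "nat \<Rightarrow> (nat \<times> nat) set \<Rightarrow> (nat \<times> nat) set \<Rightarrow> (nat \<times> nat \<Rightarrow> nat \<times> nat \<Rightarrow> int) \<Rightarrow>
   (var, 'k::field) mpoly set" where
  "I_Lambda p M N D = psubst z_to_one ` lawrence_toric_ideal p M N D"

end

theory Submission
  imports Defs
begin

text \<open>
  Let the monomial \<open>x\<^sup>u\<close> represent the word with entries \<open>\<Sum>\<^sub>l u\<^sub>i\<^sub>l \<alpha>\<^sup>l\<close>.  The binomial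
  \<open>x\<^sup>u - x\<^sup>v\<close> lies in \<open>I\<^sub>+(C)\<close> if and only if the two words differ by a codeword, that is, have
  the same syndrome (\<open>binomial_in_I_plus_iff\<close>): modulo \<open>I_q\<close> every monomial is congruent to the
  crossing monomial of its word.  Likewise \<open>x\<^sup>s y\<^sup>t - x\<^sup>s\<^sup>' y\<^sup>t\<^sup>'\<close> lies in the Lawrence-type ideal
  if and only if \<open>s + t = s' + t'\<close> and \<open>s\<close>, \<open>s'\<close> have the same syndrome: setting \<open>z\<close> to 1 turns
  the equations of the upper rows into congruences modulo \<open>p\<close>, and these are the coordinates over
  the prime field of the equality of syndromes.  Moreover both ideals are spanned by such
  differences (\<open>I_Lambda_in_kernel\<close>, \<open>binomial_in_I_Lambda\<close>).

  Consequently a pair \<open>(u, v)\<close> of equal syndrome corresponds to the Lawrence binomial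
  \<open>x\<^sup>u y\<^sup>v - x\<^sup>v y\<^sup>u\<close>, divisibility of pairs corresponds to divisibility of Lawrence binomials,
  and each binomial of the Lawrence-type ideal with relatively prime monomials is of this form.

  What remains is a fact about ideals spanned by differences of monomials of equal degree.  A
  monomial is standard if no leading monomial of the reduced Groebner basis divides it; each
  degree has at most one standard monomial.  This makes every element of the basis a binomial
  (\<open>G_binomial\<close>), and reducedness makes it primitive (\<open>G_primitive\<close>).  So a Lawrence binomial in
  the basis comes from a primitive binomial of \<open>I\<^sub>+(C)\<close>.  Conversely, if \<open>x\<^sup>u - x\<^sup>v\<close> is primitive,
  the larger monomial of its Lawrence binomial is divisible by the leading monomial of a basis
  element; this element is a Lawrence binomial whose pair divides \<open>(u, v)\<close> or \<open>(v, u)\<close>, so by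
  primitivity it is the given one up to sign.
\<close>

section \<open>Regrading polynomials\<close>

lemma poly_mapping_eq_sum_single:
  fixes f :: "'a \<Rightarrow>\<^sub>0 'b::comm_monoid_add"
  shows "f = (\<Sum>t\<in>Poly_Mapping.keys f. Poly_Mapping.single t (Poly_Mapping.lookup f t))"
proof (rule poly_mapping_eqI)
  fix x
  have "(\<Sum>t\<in>Poly_Mapping.keys f. Poly_Mapping.lookup f t when t = x) =
      (\<Sum>t\<in>Poly_Mapping.keys f. if t = x then Poly_Mapping.lookup f t else 0)"
    by (simp add: when_def)
  then show "Poly_Mapping.lookup f x = Poly_Mapping.lookup
      (\<Sum>t\<in>Poly_Mapping.keys f. Poly_Mapping.single t (Poly_Mapping.lookup f t)) x"
    by (simp add: lookup_sum lookup_single in_keys_iff)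
qed

text \<open>
  Each exponent \<open>t\<close> is replaced by its degree \<open>\<psi> t\<close>, and the coefficients of exponents of equal
  degree are added up.  So \<open>regrade \<psi> f = 0\<close> says that the coefficients of \<open>f\<close> sum to zero over
  every fibre of \<open>\<psi>\<close>; this is how the ideals below are described from the outside, without any
  algebraic structure on the set of degrees.  The same map with \<open>\<psi>\<close> forgetting the
  \<open>z\<close>-variables is the substitution \<open>z \<mapsto> 1\<close>.
\<close>

definition regrade :: "('a \<Rightarrow> 'b) \<Rightarrow> ('a \<Rightarrow>\<^sub>0 'k::comm_monoid_add) \<Rightarrow> ('b \<Rightarrow>\<^sub>0 'k)" where
  "regrade \<psi> f = (\<Sum>t\<in>Poly_Mapping.keys f. Poly_Mapping.single (\<psi> t) (Poly_Mapping.lookup f t))"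

lemma regrade_superset:
  assumes "finite A" "Poly_Mapping.keys f \<subseteq> A"
  shows "regrade \<psi> f = (\<Sum>t\<in>A. Poly_Mapping.single (\<psi> t) (Poly_Mapping.lookup f t))"
  unfolding regrade_def using assms by (intro sum.mono_neutral_left) (auto simp: in_keys_iff)

lemma regrade_zero [simp]: "regrade \<psi> 0 = 0"
  by (simp add: regrade_def)

lemma regrade_single [simp]: "regrade \<psi> (Poly_Mapping.single t c) = Poly_Mapping.single (\<psi> t) c"
  by (simp add: regrade_def)

lemma regrade_add: "regrade \<psi> (f + g) = regrade \<psi> f + regrade \<psi> g"
proof -
  let ?A = "Poly_Mapping.keys f \<union> Poly_Mapping.keys g"
  have "regrade \<psi> (f + g) = (\<Sum>t\<in>?A. Poly_Mapping.single (\<psi> t) (Poly_Mapping.lookup (f + g) t))"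
    using Poly_Mapping.keys_add[of f g] by (intro regrade_superset) auto
  also have "\<dots> = regrade \<psi> f + regrade \<psi> g"
    by (simp add: regrade_superset[of ?A] lookup_add single_add sum.distrib)
  finally show ?thesis .
qed

lemma regrade_diff: "regrade \<psi> (f - g) = regrade \<psi> f - regrade \<psi> (g :: 'a \<Rightarrow>\<^sub>0 'k::ab_group_add)"
  using regrade_add[of \<psi> "f - g" g] by (simp add: algebra_simps)

lemma regrade_sum: "regrade \<psi> (\<Sum>i\<in>A. f i) = (\<Sum>i\<in>A. regrade \<psi> (f i))"
  by (induction A rule: infinite_finite_induct) (simp_all add: regrade_add)

lemma regrade_regrade: "regrade h (regrade \<psi> f) = regrade (\<lambda>t. h (\<psi> t)) f"
  by (simp add: regrade_def[of \<psi>] regrade_def[of "\<lambda>t. h (\<psi> t)"] regrade_sum)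

lemma lookup_regrade:
  "Poly_Mapping.lookup (regrade \<psi> f) g = (\<Sum>t\<in>Poly_Mapping.keys f. if \<psi> t = g then Poly_Mapping.lookup f t else 0)"
  by (simp add: regrade_def lookup_sum lookup_single when_def)

section \<open>Ideals of the polynomial ring\<close>

lemma monomials_zero [simp]: "0 \<in> monomials V"
  by (simp add: monomials_def)

lemma monomials_add [simp]:
  "s + t \<in> monomials V \<longleftrightarrow> s \<in> monomials V \<and> t \<in> monomials V"
proof -
  have "Poly_Mapping.keys (s + t) = Poly_Mapping.keys s \<union> Poly_Mapping.keys t"
    by (auto simp: in_keys_iff lookup_add)
  then show ?thesis by (simp add: monomials_def)
qed

lemma monomials_sum [intro]: "(\<And>i. i \<in> A \<Longrightarrow> f i \<in> monomials V) \<Longrightarrow> sum f A \<in> monomials V"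
  by (induction A rule: infinite_finite_induct) auto

lemma keys_add_monomials:
  assumes "Poly_Mapping.keys f \<subseteq> monomials V" "Poly_Mapping.keys g \<subseteq> monomials V"
  shows "Poly_Mapping.keys (f + g) \<subseteq> monomials V"
  using assms Poly_Mapping.keys_add[of f g] by blast

lemma keys_mult_monomials:
  assumes "Poly_Mapping.keys f \<subseteq> monomials V" "Poly_Mapping.keys g \<subseteq> monomials V"
  shows "Poly_Mapping.keys (f * g) \<subseteq> monomials V"
  using assms Poly_Mapping.keys_mult[of f g] by fastforce

lemma mpoly_ring_simps [simp]:
  "carrier (mpoly_ring V) = {f. Poly_Mapping.keys f \<subseteq> monomials V}"
  "mult (mpoly_ring V) = (*)" "one (mpoly_ring V) = 1"
  "zero (mpoly_ring V) = 0" "add (mpoly_ring V) = (+)"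
  by (simp_all add: mpoly_ring_def)

lemma cring_mpoly_ring: "cring (mpoly_ring V :: ('v, 'k::comm_ring_1) mpoly ring)"
proof (rule cringI)
  have "\<exists>y. Poly_Mapping.keys y \<subseteq> monomials V \<and> y + x = 0 \<and> x + y = 0"
    if "Poly_Mapping.keys x \<subseteq> monomials V" for x :: "('v, 'k) mpoly"
    using that by (intro exI[of _ "- x"]) (simp add: in_keys_iff subset_iff)
  then show "abelian_group (mpoly_ring V :: ('v, 'k) mpoly ring)"
    using keys_add_monomials by (intro abelian_groupI) (simp_all add: ac_simps)
  show "comm_monoid (mpoly_ring V :: ('v, 'k) mpoly ring)"
    by (rule comm_monoidI) (simp_all add: keys_mult_monomials ac_simps)
qed (simp add: algebra_simps)

lemma ring_mpoly_ring: "ring (mpoly_ring V :: ('v, 'k::comm_ring_1) mpoly ring)"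
  using cring_mpoly_ring by (rule cring.axioms)

text \<open>Since polynomials are sums of terms, closure under multiplication by terms suffices.\<close>

lemma ideal_mpoly_ringI:
  fixes J :: "('v, 'k::comm_ring_1) mpoly set"
  assumes sub: "\<And>f. f \<in> J \<Longrightarrow> Poly_Mapping.keys f \<subseteq> monomials V"
    and zero: "0 \<in> J"
    and add: "\<And>f g. f \<in> J \<Longrightarrow> g \<in> J \<Longrightarrow> f + g \<in> J"
    and term_mult: "\<And>f w c. f \<in> J \<Longrightarrow> w \<in> monomials V \<Longrightarrow> Poly_Mapping.single w c * f \<in> J"
  shows "ideal J (mpoly_ring V)"
proof -
  interpret R: cring "mpoly_ring V :: ('v, 'k) mpoly ring" by (rule cring_mpoly_ring)
  have sum: "(\<Sum>i\<in>A. h i) \<in> J" if "\<And>i. i \<in> A \<Longrightarrow> h i \<in> J" for A and h :: "('v \<Rightarrow>\<^sub>0 nat) \<Rightarrow> _"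
    using that by (induction A rule: infinite_finite_induct) (auto intro: zero add)
  have mult: "g * f \<in> J" if "f \<in> J" "Poly_Mapping.keys g \<subseteq> monomials V" for f g
  proof -
    have "g * f = (\<Sum>t\<in>Poly_Mapping.keys g. Poly_Mapping.single t (Poly_Mapping.lookup g t) * f)"
      by (subst poly_mapping_eq_sum_single[of g]) (simp add: sum_distrib_right)
    also have "\<dots> \<in> J" using that by (intro sum term_mult) auto
    finally show ?thesis .
  qed
  have neg: "- f \<in> J" if "f \<in> J" for f
    using term_mult[OF that, of 0 "-1"] by (simp add: single_uminus)
  show ?thesis
  proof (rule idealI)
    show "subgroup J (add_monoid (mpoly_ring V))"
    proof (rule R.add.subgroupI)
      show "\<ominus>\<^bsub>mpoly_ring V\<^esub> a \<in> J" if "a \<in> J" for a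
      proof -
        have "\<ominus>\<^bsub>mpoly_ring V\<^esub> a = - a"
          using sub[OF that] sub[OF neg[OF that]] by (intro R.minus_equality) auto
        then show ?thesis using neg[OF that] by simp
      qed
    qed (use sub zero add in auto)
  qed (use mult sub in \<open>auto simp: R.ring_axioms mult.commute\<close>)
qed

lemma
  fixes J :: "('v, 'k::comm_ring_1) mpoly set"
  assumes "ideal J (mpoly_ring V)"
  shows ideal_mpoly_ring_subset: "f \<in> J \<Longrightarrow> Poly_Mapping.keys f \<subseteq> monomials V"
    and ideal_mpoly_ring_zero: "0 \<in> J"
    and ideal_mpoly_ring_add: "f \<in> J \<Longrightarrow> g \<in> J \<Longrightarrow> f + g \<in> J"
    and ideal_mpoly_ring_mult: "f \<in> J \<Longrightarrow> Poly_Mapping.keys h \<subseteq> monomials V \<Longrightarrow> h * f \<in> J"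
    and ideal_mpoly_ring_diff: "f \<in> J \<Longrightarrow> g \<in> J \<Longrightarrow> f - g \<in> J"
proof -
  interpret ideal J "mpoly_ring V" by fact
  show "f \<in> J \<Longrightarrow> Poly_Mapping.keys f \<subseteq> monomials V" for f using a_subset by auto
  show "0 \<in> J" using additive_subgroup.zero_closed[OF is_additive_subgroup] by simp
  show add: "f + g \<in> J" if "f \<in> J" "g \<in> J" for f g
    using additive_subgroup.a_closed[OF is_additive_subgroup that] by simp
  show mult: "h * f \<in> J" if "f \<in> J" "Poly_Mapping.keys h \<subseteq> monomials V" for f h
    using I_l_closed[OF that(1), of h] that(2) by simp
  have neg: "- f \<in> J" if "f \<in> J" for f using mult[OF that, of "- 1"] by simp
  show "f - g \<in> J" if "f \<in> J" "g \<in> J" for f g using add[OF that(1) neg[OF that(2)]] by simp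
qed

text \<open>
  If equality of degrees is preserved by translation, then multiplication by a monomial permutes
  whole fibres: translation by \<open>w\<close> induces a map \<open>h\<close> on degrees, and the regrading of a product
  with \<open>w\<close> is obtained from the regrading of \<open>f\<close> by applying \<open>h\<close>.
\<close>

lemma ideal_kernel_regrade:
  assumes "\<And>s t w. \<psi> s = \<psi> t \<Longrightarrow> \<psi> (w + s) = \<psi> (w + t)"
  shows "ideal {f :: ('v, 'k::comm_ring_1) mpoly. Poly_Mapping.keys f \<subseteq> monomials V \<and> regrade \<psi> f = 0}
    (mpoly_ring V)"
proof (rule ideal_mpoly_ringI)
  fix f :: "('v, 'k) mpoly" and w c
  assume f: "f \<in> {f. Poly_Mapping.keys f \<subseteq> monomials V \<and> regrade \<psi> f = 0}" and w: "w \<in> monomials V"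
  \<comment> \<open>the action of \<open>w\<close> on degrees; the choice of a representative does not matter by assumption\<close>
  define h where "h g = \<psi> (w + (SOME t. \<psi> t = g))" for g
  have h: "\<psi> (w + t) = h (\<psi> t)" for t
    unfolding h_def by (rule assms, rule someI2[of _ t]) auto
  have "Poly_Mapping.single w c * f =
      (\<Sum>t\<in>Poly_Mapping.keys f. Poly_Mapping.single (w + t) (c * Poly_Mapping.lookup f t))"
    by (subst poly_mapping_eq_sum_single[of f]) (simp add: sum_distrib_left mult_single)
  then have "regrade \<psi> (Poly_Mapping.single w c * f) =
      (\<Sum>t\<in>Poly_Mapping.keys f. Poly_Mapping.single (h (\<psi> t)) (c * Poly_Mapping.lookup f t))"
    by (simp add: regrade_sum h)
  also have "\<dots> = 0"
  proof (rule poly_mapping_eqI)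
    fix k
    have "regrade (\<lambda>t. h (\<psi> t)) f = 0" using f regrade_regrade[of h \<psi> f] by simp
    then have "0 = c * (\<Sum>t\<in>Poly_Mapping.keys f. if h (\<psi> t) = k then Poly_Mapping.lookup f t else 0)"
      using lookup_regrade[of "\<lambda>t. h (\<psi> t)" f k] by simp
    then show "Poly_Mapping.lookup (\<Sum>t\<in>Poly_Mapping.keys f.
        Poly_Mapping.single (h (\<psi> t)) (c * Poly_Mapping.lookup f t)) k = Poly_Mapping.lookup 0 k"
      by (simp add: lookup_sum lookup_single when_def sum_distrib_left if_distrib cong: if_cong)
  qed
  finally show "Poly_Mapping.single w c * f \<in> {f. Poly_Mapping.keys f \<subseteq> monomials V \<and> regrade \<psi> f = 0}"
    using f w keys_mult_monomials[of "Poly_Mapping.single w c" V f] by simp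
qed (simp_all add: regrade_add keys_add_monomials)

section \<open>Monomials and monomial orders\<close>

lemma lookup_mon: "Poly_Mapping.lookup (mon t) s = (if s = t then 1 else 0)"
  by (simp add: mon_def lookup_single when_def)

lemma keys_mon [simp]: "Poly_Mapping.keys (mon t :: ('v, 'k::field) mpoly) = {t}"
  by (simp add: mon_def)

lemma mon_eq_iff [simp]: "(mon s :: ('v, 'k::field) mpoly) = mon t \<longleftrightarrow> s = t"
  by (metis keys_mon singleton_inject)

lemma mon_add: "mon (s + t) = (mon s * mon t :: ('v, 'k::comm_ring_1) mpoly)"
  by (simp add: mon_def mult_single)

lemma mon_zero [simp]: "mon 0 = 1"
  by (simp add: mon_def)

lemma mon_dvd_mon_iff:
  "(mon w :: ('v, 'k::field) mpoly) dvd mon u \<longleftrightarrow> (\<exists>t. u = w + t)"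
proof
  assume "(mon w :: ('v, 'k) mpoly) dvd mon u"
  then obtain g :: "('v, 'k) mpoly" where "mon u = mon w * g" by (elim dvdE)
  then have "u \<in> Poly_Mapping.keys (mon w * g)" by (metis insertI1 keys_mon)
  then show "\<exists>t. u = w + t" using Poly_Mapping.keys_mult[of "mon w" g] by auto
qed (auto simp: mon_add)

lemma regrade_mon [simp]: "regrade \<psi> (mon t) = Poly_Mapping.single (\<psi> t) 1"
  by (simp add: mon_def)

lemma keys_mon_diff:
  "s \<noteq> t \<Longrightarrow> Poly_Mapping.keys (mon s - mon t :: ('v, 'k::field) mpoly) = {s, t}"
  by (auto simp: in_keys_iff lookup_minus lookup_mon split: if_splits)

text \<open>
  The second alternative cannot be excluded here: in characteristic 2 a binomial does not know
  which of its two monomials comes first.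
\<close>

lemma mon_diff_eq_mon_diffD:
  assumes "mon s - mon t = (mon s' - mon t' :: ('v, 'k::field) mpoly)" "s \<noteq> t"
  shows "s = s' \<and> t = t' \<or> s = t' \<and> t = s'"
proof -
  have "s' \<noteq> t'" using assms by (metis diff_self mon_eq_iff right_minus_eq)
  then have "{s, t} = {s', t'}" using assms keys_mon_diff by metis
  then show ?thesis by (auto simp: doubleton_eq_iff)
qed

locale monomial_ordering =
  fixes V :: "'v set" and R :: "('v \<Rightarrow>\<^sub>0 nat) rel"
  assumes order: "monomial_order V R"
begin

lemma
  shows order_refl: "t \<in> monomials V \<Longrightarrow> (t, t) \<in> R"
    and order_antisym: "(s, t) \<in> R \<Longrightarrow> (t, s) \<in> R \<Longrightarrow> s = t"
    and order_trans: "(s, t) \<in> R \<Longrightarrow> (t, w) \<in> R \<Longrightarrow> (s, w) \<in> R"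
    and order_total: "s \<in> monomials V \<Longrightarrow> t \<in> monomials V \<Longrightarrow> (s, t) \<in> R \<or> (t, s) \<in> R"
    and order_wf: "wf (R - Id)"
    and order_add: "(s, t) \<in> R \<Longrightarrow> w \<in> monomials V \<Longrightarrow> (s + w, t + w) \<in> R"
proof -
  note d = order[unfolded monomial_order_def order_on_defs refl_on_def antisym_def trans_def total_on_def]
  show "t \<in> monomials V \<Longrightarrow> (t, t) \<in> R" using d by blast
  show "(s, t) \<in> R \<Longrightarrow> (t, s) \<in> R \<Longrightarrow> s = t" using d by blast
  show "(s, t) \<in> R \<Longrightarrow> (t, w) \<in> R \<Longrightarrow> (s, w) \<in> R" using d by blast
  show "s \<in> monomials V \<Longrightarrow> t \<in> monomials V \<Longrightarrow> (s, t) \<in> R \<or> (t, s) \<in> R" using d by metis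
  show "wf (R - Id)" using d by blast
  show "(s, t) \<in> R \<Longrightarrow> w \<in> monomials V \<Longrightarrow> (s + w, t + w) \<in> R" using d by blast
qed

lemma order_zero:
  assumes "w \<in> monomials V"
  shows "(0, w) \<in> R"
proof (rule ccontr)
  assume "(0, w) \<notin> R"
  then have w: "(w, 0) \<in> R" "w \<noteq> 0" using order_total[of 0 w] order_refl[of 0] assms by auto
  \<comment> \<open>otherwise the multiples of \<open>w\<close> would form a strictly descending chain\<close>
  define c where "c i = ((+) w ^^ i) 0" for i
  have "c i \<in> monomials V" for i using assms by (induction i) (simp_all add: c_def)
  then have "(w + c i, 0 + c i) \<in> R" for i using order_add[OF w(1)] by blast
  then have "(c (Suc i), c i) \<in> R - Id" for i using w(2) by (simp add: c_def)
  then show False using order_wf unfolding wf_iff_no_infinite_down_chain by blast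
qed

lemma order_add_right:
  "s \<in> monomials V \<Longrightarrow> w \<in> monomials V \<Longrightarrow> (s, s + w) \<in> R"
  using order_add[OF order_zero, of w s] by (simp add: add.commute)

lemma finite_has_maximum:
  assumes "finite A" "A \<noteq> {}" "A \<subseteq> monomials V"
  shows "\<exists>t\<in>A. \<forall>s\<in>A. (s, t) \<in> R"
  using assms
proof (induction A rule: finite_ne_induct)
  case (singleton x)
  then show ?case using order_refl by simp
next
  case (insert x F)
  then obtain t where t: "t \<in> F" "\<forall>s\<in>F. (s, t) \<in> R" by auto
  have "(x, x) \<in> R" using insert order_refl by auto
  consider "(x, t) \<in> R" | "(t, x) \<in> R" using order_total[of x t] insert t by auto
  then show ?case
  proof cases
    case 1
    then show ?thesis using t by auto
  next
    case 2
    then show ?thesis using t \<open>(x, x) \<in> R\<close> order_trans by (intro bexI[of _ x]) blast+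
  qed
qed

lemma lead_expI:
  "t \<in> Poly_Mapping.keys f \<Longrightarrow> (\<And>s. s \<in> Poly_Mapping.keys f \<Longrightarrow> (s, t) \<in> R) \<Longrightarrow> lead_exp R f = t"
  unfolding lead_exp_def by (rule the_equality) (auto intro: order_antisym)

lemma
  assumes "f \<noteq> 0" "Poly_Mapping.keys f \<subseteq> monomials V"
  shows lead_exp_in_keys: "lead_exp R f \<in> Poly_Mapping.keys f"
    and lead_exp_maximum: "\<And>s. s \<in> Poly_Mapping.keys f \<Longrightarrow> (s, lead_exp R f) \<in> R"
proof -
  have "Poly_Mapping.keys f \<noteq> {}" using assms(1) by (simp add: poly_mapping_eq_iff fun_eq_iff in_keys_iff set_eq_iff)
  then obtain t where t: "t \<in> Poly_Mapping.keys f" "\<And>s. s \<in> Poly_Mapping.keys f \<Longrightarrow> (s, t) \<in> R"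
    using finite_has_maximum[of "Poly_Mapping.keys f"] assms(2) by auto
  then have "lead_exp R f = t" by (rule lead_expI)
  then show "lead_exp R f \<in> Poly_Mapping.keys f" "\<And>s. s \<in> Poly_Mapping.keys f \<Longrightarrow> (s, lead_exp R f) \<in> R"
    using t by auto
qed

lemma lead_exp_mon_diff:
  assumes "(s, t) \<in> R" "s \<noteq> t" "t \<in> monomials V"
  shows "lead_exp R (mon t - mon s :: ('v, 'k::field) mpoly) = t"
  using assms by (intro lead_expI) (auto simp: keys_mon_diff order_refl)

text \<open>
  The polynomials all of whose monomials are divisible by some leading monomial form an ideal
  containing the generators of the initial ideal.
\<close>

lemma divisible_if_mon_in_initial_ideal:
  fixes F :: "('v, 'k::field) mpoly set"
  assumes F: "\<And>f. f \<in> F \<Longrightarrow> Poly_Mapping.keys f \<subseteq> monomials V"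
    and t: "mon t \<in> initial_ideal V R F"
  shows "\<exists>f\<in>F. f \<noteq> 0 \<and> (\<exists>w. t = lead_exp R f + w)"
proof -
  let ?D = "\<lambda>t. \<exists>f\<in>F. f \<noteq> 0 \<and> (\<exists>w. t = lead_exp R f + w)"
  let ?J = "{f :: ('v, 'k) mpoly. Poly_Mapping.keys f \<subseteq> monomials V \<and> (\<forall>t\<in>Poly_Mapping.keys f. ?D t)}"
  have "ideal ?J (mpoly_ring V)"
  proof (rule ideal_mpoly_ringI)
    fix f :: "('v, 'k) mpoly" and w c assume f: "f \<in> ?J" and w: "w \<in> monomials V"
    have "?D t" if "t \<in> Poly_Mapping.keys (Poly_Mapping.single w c * f)" for t
    proof -
      obtain s where s: "s \<in> Poly_Mapping.keys f" "t = w + s"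
        using \<open>t \<in> _\<close> Poly_Mapping.keys_mult[of "Poly_Mapping.single w c" f] by (auto split: if_splits)
      then obtain h w' where "h \<in> F" "h \<noteq> 0" "s = lead_exp R h + w'" using f by blast
      then show ?thesis
        using s(2) by (intro bexI[of _ h] conjI exI[of _ "w + w'"]) (simp_all add: ac_simps)
    qed
    then show "Poly_Mapping.single w c * f \<in> ?J"
      using f w keys_mult_monomials[of "Poly_Mapping.single w c" V f] by auto
  next
    fix f g :: "('v, 'k) mpoly" assume "f \<in> ?J" "g \<in> ?J"
    then show "f + g \<in> ?J"
      using Poly_Mapping.keys_add[of f g] by blast
  qed auto
  moreover have "{mon (lead_exp R f) | f. f \<in> F \<and> f \<noteq> 0} \<subseteq> ?J"
  proof -
    have "lead_exp R f \<in> monomials V" "?D (lead_exp R f)" if "f \<in> F" "f \<noteq> 0" for f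
    proof -
      show "lead_exp R f \<in> monomials V" using that F lead_exp_in_keys by blast
      show "?D (lead_exp R f)" using that by (intro bexI[of _ f] conjI exI[of _ 0]) simp_all
    qed
    then show ?thesis by auto
  qed
  ultimately have "initial_ideal V R F \<subseteq> ?J"
    unfolding initial_ideal_def by (rule ring.genideal_minimal[OF ring_mpoly_ring])
  then have "mon t \<in> ?J" using t by blast
  then show ?thesis by simp
qed

end

section \<open>Reduced Groebner bases of ideals spanned by binomials\<close>

text \<open>
  The first three assumptions pin down \<open>I\<close> as the ideal spanned by all differences of monomials
  of equal degree \<open>\<psi>\<close>: it contains these differences, and it is contained in the kernel of the
  regrading.
\<close>

locale binomial_groebner_basis = monomial_ordering V R
  for V :: "'v set" and R :: "('v \<Rightarrow>\<^sub>0 nat) rel" +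
  fixes I G :: "('v, 'k::field) mpoly set" and \<psi> :: "('v \<Rightarrow>\<^sub>0 nat) \<Rightarrow> 'g"
  assumes keys_I: "f \<in> I \<Longrightarrow> Poly_Mapping.keys f \<subseteq> monomials V"
    and regrade_I: "f \<in> I \<Longrightarrow> regrade \<psi> f = 0"
    and binomial_in_I: "s \<in> monomials V \<Longrightarrow> t \<in> monomials V \<Longrightarrow> \<psi> s = \<psi> t \<Longrightarrow> mon s - mon t \<in> I"
    and reduced: "reduced_groebner_basis V R I G"
begin

lemma
  shows G_subset_I: "G \<subseteq> I"
    and initial_ideal_G: "initial_ideal V R G = initial_ideal V R I"
    and G_nonzero: "g \<in> G \<Longrightarrow> g \<noteq> 0"
    and G_monic: "g \<in> G \<Longrightarrow> Poly_Mapping.lookup g (lead_exp R g) = 1"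
    and G_reduced: "g \<in> G \<Longrightarrow> h \<in> G \<Longrightarrow> h \<noteq> g \<Longrightarrow> t \<in> Poly_Mapping.keys g \<Longrightarrow> t \<noteq> lead_exp R h + w"
  using reduced unfolding reduced_groebner_basis_def groebner_basis_def mon_dvd_mon_iff by blast+

lemma lead_exp_divisible:
  assumes "f \<in> I" "f \<noteq> 0"
  shows "\<exists>h\<in>G. \<exists>w. lead_exp R f = lead_exp R h + w"
proof -
  have "lead_exp R f \<in> monomials V" if "f \<in> I" "f \<noteq> 0" for f
    using that keys_I lead_exp_in_keys by blast
  then have sub: "{mon (lead_exp R f) | f. f \<in> I \<and> f \<noteq> 0} \<subseteq> carrier (mpoly_ring V :: ('v, 'k) mpoly ring)"
    by auto
  have "mon (lead_exp R f) \<in> initial_ideal V R I"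
    unfolding initial_ideal_def using ring.genideal_self[OF ring_mpoly_ring sub] assms by blast
  then have "\<exists>h\<in>G. h \<noteq> 0 \<and> (\<exists>w. lead_exp R f = lead_exp R h + w)"
    using G_subset_I keys_I by (intro divisible_if_mon_in_initial_ideal) (auto simp: initial_ideal_G)
  then show ?thesis by blast
qed

lemma larger_monomial_divisible:
  assumes "s \<in> monomials V" "t \<in> monomials V" "\<psi> s = \<psi> t" "s \<noteq> t" "(s, t) \<in> R"
  shows "\<exists>h\<in>G. \<exists>w. t = lead_exp R h + w"
proof -
  have "mon t - mon s \<in> I" using assms binomial_in_I by auto
  moreover have "mon t - mon s \<noteq> (0 :: ('v, 'k) mpoly)" using assms by simp
  ultimately show ?thesis using lead_exp_divisible assms lead_exp_mon_diff by metis
qed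

definition standard :: "('v \<Rightarrow>\<^sub>0 nat) \<Rightarrow> bool" where
  "standard t \<longleftrightarrow> t \<in> monomials V \<and> \<not> (\<exists>h\<in>G. \<exists>w. t = lead_exp R h + w)"

text \<open>
  Of two monomials of equal degree the larger one is the leading monomial of their difference,
  which lies in \<open>I\<close>.
\<close>

lemma standard_unique: "standard s \<Longrightarrow> standard t \<Longrightarrow> \<psi> s = \<psi> t \<Longrightarrow> s = t"
  using larger_monomial_divisible[of s t] larger_monomial_divisible[of t s] order_total[of s t]
  unfolding standard_def by fastforce

lemma lead_exp_G: "g \<in> G \<Longrightarrow> lead_exp R g \<in> Poly_Mapping.keys g"
  using lead_exp_in_keys G_nonzero G_subset_I keys_I by blast

text \<open>
  Leading monomials of other basis elements are excluded by reducedness, and the leading monomial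
  of \<open>g\<close> itself is larger than \<open>t\<close>.
\<close>

lemma tail_standard:
  assumes g: "g \<in> G" and t: "t \<in> Poly_Mapping.keys g" "t \<noteq> lead_exp R g"
  shows "standard t"
proof -
  have tV: "t \<in> monomials V" using g t G_subset_I keys_I by blast
  have "t \<noteq> lead_exp R h + w" if "h \<in> G" for h w
  proof (cases "h = g")
    case True
    show ?thesis
    proof
      assume eq: "t = lead_exp R h + w"
      then have "(lead_exp R g, t) \<in> R" using tV True order_add_right by auto
      moreover have "(t, lead_exp R g) \<in> R"
        using lead_exp_maximum[OF G_nonzero[OF g]] g t G_subset_I keys_I by blast
      ultimately show False using t order_antisym by blast
    qed
  qed (use G_reduced g that t in blast)
  then show ?thesis using tV by (auto simp: standard_def)
qed

text \<open>
  All monomials of \<open>g\<close> except the leading one are standard, so each degree contributes at most one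
  of them.  Since the coefficients sum to zero in each degree, a degree without the leading
  monomial contributes none, and the degree of the leading monomial contributes exactly one,
  with coefficient \<open>- 1\<close>.
\<close>

lemma G_binomial:
  assumes g: "g \<in> G"
  obtains s where "s \<in> monomials V" "s \<noteq> lead_exp R g" "\<psi> s = \<psi> (lead_exp R g)" "standard s"
    "g = mon (lead_exp R g) - mon s"
proof -
  let ?T = "lead_exp R g"
  have class_sum: "(\<Sum>t\<in>Poly_Mapping.keys g. if \<psi> t = c then Poly_Mapping.lookup g t else 0) = 0" for c
    using regrade_I[of g] G_subset_I g lookup_regrade[of \<psi> g c] by auto
  have T: "?T \<in> Poly_Mapping.keys g" using lead_exp_G g by blast
  have "\<exists>s\<in>Poly_Mapping.keys g. s \<noteq> ?T \<and> \<psi> s = \<psi> ?T"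
  proof (rule ccontr)
    assume "\<not> ?thesis"
    then have "(\<Sum>t\<in>Poly_Mapping.keys g. if \<psi> t = \<psi> ?T then Poly_Mapping.lookup g t else 0) =
        (\<Sum>t\<in>Poly_Mapping.keys g. if t = ?T then Poly_Mapping.lookup g t else 0)"
      by (intro sum.cong) auto
    also have "\<dots> = 1" using T G_monic g by simp
    finally show False using class_sum by simp
  qed
  then obtain s where s: "s \<in> Poly_Mapping.keys g" "s \<noteq> ?T" "\<psi> s = \<psi> ?T" by blast
  have std: "standard s" using tail_standard g s by blast
  have keys: "Poly_Mapping.keys g = {?T, s}"
  proof -
    have False if t: "t \<in> Poly_Mapping.keys g" "t \<noteq> ?T" "t \<noteq> s" for t
    proof -
      have stdt: "standard t" using tail_standard g t by blast
      have "\<psi> t \<noteq> \<psi> ?T" using standard_unique[OF stdt std] t s by auto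
      then have "(\<Sum>t'\<in>Poly_Mapping.keys g. if \<psi> t' = \<psi> t then Poly_Mapping.lookup g t' else 0) =
          (\<Sum>t'\<in>Poly_Mapping.keys g. if t' = t then Poly_Mapping.lookup g t' else 0)"
        using tail_standard[OF g] standard_unique[OF _ stdt] by (intro sum.cong) metis+
      also have "\<dots> = Poly_Mapping.lookup g t" using t by simp
      finally show False using class_sum t by (simp add: in_keys_iff)
    qed
    then show ?thesis using s T by blast
  qed
  have "0 = (\<Sum>t\<in>{?T, s}. if \<psi> t = \<psi> ?T then Poly_Mapping.lookup g t else 0)"
    using class_sum[of "\<psi> ?T"] keys by metis
  also have "\<dots> = 1 + Poly_Mapping.lookup g s"
    using s(2,3) G_monic[OF g] by simp
  finally have gs: "Poly_Mapping.lookup g s = - 1" using add_eq_0_iff by metis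
  have "g = mon ?T - mon s"
  proof (rule poly_mapping_eqI)
    fix t
    consider "t = ?T" | "t = s" | "t \<notin> Poly_Mapping.keys g" "t \<noteq> ?T" "t \<noteq> s" using keys by blast
    then show "Poly_Mapping.lookup g t = Poly_Mapping.lookup (mon ?T - mon s) t"
      using s(2) G_monic[OF g] gs by cases (simp_all add: lookup_minus lookup_mon in_keys_iff)
  qed
  then show thesis using that std s by (meson standard_def)
qed

text \<open>
  Elements of a reduced Groebner basis are primitive.  Let \<open>t'\<close> and \<open>s'\<close> have the same degree and
  divide the leading monomial \<open>T\<close> and the standard monomial \<open>s\<close>, respectively.  The smaller of them
  cannot be \<open>t'\<close>, since then \<open>s'\<close>, hence \<open>s\<close>, would not be standard.  So \<open>t'\<close> is divisible by a
  leading monomial, which by reducedness is \<open>T\<close>; thus \<open>t' = T\<close>, and then \<open>s'\<close> and \<open>s\<close> are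
  standard of the same degree.
\<close>

lemma G_primitive:
  assumes g: "mon a - mon b \<in> G"
  shows "a \<in> monomials V" "b \<in> monomials V" "a \<noteq> b" "\<psi> a = \<psi> b"
    and "a' \<noteq> b' \<Longrightarrow> \<psi> a' = \<psi> b' \<Longrightarrow> a = a' + w \<Longrightarrow> b = b' + w' \<Longrightarrow> a' = a \<and> b' = b"
proof -
  obtain s where s: "s \<in> monomials V" "s \<noteq> lead_exp R (mon a - mon b :: ('v, 'k) mpoly)"
    "\<psi> s = \<psi> (lead_exp R (mon a - mon b :: ('v, 'k) mpoly))" "standard s"
    "mon a - mon b = (mon (lead_exp R (mon a - mon b :: ('v, 'k) mpoly)) - mon s :: ('v, 'k) mpoly)"
    using G_binomial g by blast
  define T where "T = lead_exp R (mon a - mon b :: ('v, 'k) mpoly)"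
  have "a \<noteq> b" using G_nonzero[OF g] by auto
  then have ab: "a = T \<and> b = s \<or> a = s \<and> b = T"
    using mon_diff_eq_mon_diffD s(5) unfolding T_def by blast
  have TV: "T \<in> monomials V" using lead_exp_G[OF g] keys_I G_subset_I g unfolding T_def by blast
  show "a \<in> monomials V" "b \<in> monomials V" "a \<noteq> b" "\<psi> a = \<psi> b"
    using ab TV s unfolding T_def by auto
  \<comment> \<open>stated for the leading and the tail monomial, since \<open>a\<close> and \<open>b\<close> may be either of them\<close>
  have *: "t' = T \<and> s' = s"
    if ne: "t' \<noteq> s'" and eq: "\<psi> t' = \<psi> s'" and t': "T = t' + w" and s': "s = s' + w'" for t' s' w w'
  proof -
    have V: "t' \<in> monomials V" "s' \<in> monomials V" "w \<in> monomials V" using TV s(1) t' s' by auto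
    have std': "standard s'"
      using s(4) s' V unfolding standard_def by (metis add.assoc)
    then have "(t', s') \<notin> R"
      using larger_monomial_divisible[of t' s'] V ne eq unfolding standard_def by blast
    then have "(s', t') \<in> R" using order_total V by blast
    then obtain h w1 where h: "h \<in> G" "t' = lead_exp R h + w1"
      using larger_monomial_divisible[of s' t'] V ne eq by auto
    then have "T = lead_exp R h + (w1 + w)" using t' by (simp add: ac_simps)
    then have "h = mon a - mon b"
      using G_reduced[OF g h(1)] lead_exp_G[OF g] unfolding T_def by blast
    then have "t' = T + w1" using h unfolding T_def by simp
    then have "w1 + w = 0" using t' by (metis add.assoc add_cancel_right_right)
    then have "w = 0" by (auto simp: poly_mapping_eq_iff fun_eq_iff lookup_add)
    then have "t' = T" using t' by simp
    then have "standard s'" "\<psi> s' = \<psi> s" using std' eq s(3) unfolding T_def by auto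
    then show ?thesis using \<open>t' = T\<close> standard_unique s(4) by auto
  qed
  show "a' \<noteq> b' \<Longrightarrow> \<psi> a' = \<psi> b' \<Longrightarrow> a = a' + w \<Longrightarrow> b = b' + w' \<Longrightarrow> a' = a \<and> b' = b"
    using ab *[of a' b' w w'] *[of b' a' w' w] by auto
qed

end

section \<open>Exponent vectors in the variables x, y, z\<close>

lemma
  shows lookup_rename_exp: "inj \<phi> \<Longrightarrow> Poly_Mapping.lookup (rename_exp \<phi> u) (\<phi> i) = Poly_Mapping.lookup u i"
    and lookup_rename_exp_notin: "v \<notin> range \<phi> \<Longrightarrow> Poly_Mapping.lookup (rename_exp \<phi> u) v = 0"
proof -
  assume "inj \<phi>"
  then have "Poly_Mapping.lookup (rename_exp \<phi> u) (\<phi> i) =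
      (\<Sum>j\<in>Poly_Mapping.keys u. if j = i then Poly_Mapping.lookup u j else 0)"
    by (simp add: rename_exp_def lookup_sum lookup_single when_def inj_eq)
  then show "Poly_Mapping.lookup (rename_exp \<phi> u) (\<phi> i) = Poly_Mapping.lookup u i"
    by (simp add: in_keys_iff)
next
  assume v: "v \<notin> range \<phi>"
  then have "\<phi> j \<noteq> v" for j by blast
  then show "Poly_Mapping.lookup (rename_exp \<phi> u) v = 0"
    by (simp add: rename_exp_def lookup_sum lookup_single when_def)
qed

lemma inj_X: "inj X" and inj_Y: "inj Y"
  by (auto intro: injI)

lemma lookup_rename_X_Y [simp]:
  "Poly_Mapping.lookup (rename_exp X u) (X c) = Poly_Mapping.lookup u c"
  "Poly_Mapping.lookup (rename_exp X u) (Y c) = 0"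
  "Poly_Mapping.lookup (rename_exp X u) (Z c) = 0"
  "Poly_Mapping.lookup (rename_exp Y u) (X c) = 0"
  "Poly_Mapping.lookup (rename_exp Y u) (Y c) = Poly_Mapping.lookup u c"
  "Poly_Mapping.lookup (rename_exp Y u) (Z c) = 0"
  by (simp_all add: lookup_rename_exp inj_X inj_Y lookup_rename_exp_notin image_iff)

lemma rename_exp_add: "rename_exp \<phi> (u + v) = rename_exp \<phi> u + rename_exp \<phi> v"
proof -
  have *: "rename_exp \<phi> w =
      (\<Sum>i\<in>Poly_Mapping.keys u \<union> Poly_Mapping.keys v. Poly_Mapping.single (\<phi> i) (Poly_Mapping.lookup w i))"
    if "Poly_Mapping.keys w \<subseteq> Poly_Mapping.keys u \<union> Poly_Mapping.keys v" for w
    unfolding rename_exp_def using that by (intro sum.mono_neutral_left) (auto simp: in_keys_iff)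
  have "rename_exp \<phi> (u + v) = (\<Sum>i\<in>Poly_Mapping.keys u \<union> Poly_Mapping.keys v.
      Poly_Mapping.single (\<phi> i) (Poly_Mapping.lookup (u + v) i))"
    using Poly_Mapping.keys_add[of u v] by (intro *) auto
  then show ?thesis by (simp add: * lookup_add single_add sum.distrib)
qed

lemma rename_exp_zero [simp]: "rename_exp \<phi> 0 = 0"
  by (simp add: rename_exp_def)

lemma rename_exp_single [simp]: "rename_exp \<phi> (Poly_Mapping.single c k) = Poly_Mapping.single (\<phi> c) k"
  by (simp add: rename_exp_def)

lemma rename_exp_inject [simp]:
  "rename_exp X u = rename_exp X v \<longleftrightarrow> u = v"
proof
  assume "rename_exp X u = rename_exp X v"
  then have "Poly_Mapping.lookup u c = Poly_Mapping.lookup v c" for c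
    using lookup_rename_X_Y(1) by metis
  then show "u = v" by (rule poly_mapping_eqI)
qed simp

lemma rename_X_in_monomials [simp]:
  "rename_exp X u \<in> monomials (X ` N) \<longleftrightarrow> Poly_Mapping.keys u \<subseteq> N"
proof
  assume l: "rename_exp X u \<in> monomials (X ` N)"
  show "Poly_Mapping.keys u \<subseteq> N"
  proof
    fix c assume "c \<in> Poly_Mapping.keys u"
    then have "X c \<in> Poly_Mapping.keys (rename_exp X u)" by (simp add: in_keys_iff)
    then show "c \<in> N" using l by (auto simp: monomials_def)
  qed
next
  assume u: "Poly_Mapping.keys u \<subseteq> N"
  have "v \<in> X ` N" if "v \<in> Poly_Mapping.keys (rename_exp X u)" for v
    using that u by (cases v) (auto simp: in_keys_iff subset_iff)
  then show "rename_exp X u \<in> monomials (X ` N)" by (auto simp: monomials_def)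
qed

lemma rename_in_monomials_XY:
  "Poly_Mapping.keys u \<subseteq> N \<Longrightarrow> rename_exp X u \<in> monomials (X ` N \<union> Y ` N)"
  "Poly_Mapping.keys u \<subseteq> N \<Longrightarrow> rename_exp Y u \<in> monomials (X ` N \<union> Y ` N)"
proof -
  assume u: "Poly_Mapping.keys u \<subseteq> N"
  have "v \<in> X ` N \<union> Y ` N" if "v \<in> Poly_Mapping.keys (rename_exp X u)" for v
    using that u by (cases v) (auto simp: in_keys_iff subset_iff)
  then show "rename_exp X u \<in> monomials (X ` N \<union> Y ` N)" by (auto simp: monomials_def)
  have "v \<in> X ` N \<union> Y ` N" if "v \<in> Poly_Mapping.keys (rename_exp Y u)" for v
    using that u by (cases v) (auto simp: in_keys_iff subset_iff)
  then show "rename_exp Y u \<in> monomials (X ` N \<union> Y ` N)" by (auto simp: monomials_def)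
qed

definition xpart :: "(var \<Rightarrow>\<^sub>0 nat) \<Rightarrow> (nat \<times> nat \<Rightarrow>\<^sub>0 nat)" where
  "xpart t = Poly_Mapping.map_key X t"

definition ypart :: "(var \<Rightarrow>\<^sub>0 nat) \<Rightarrow> (nat \<times> nat \<Rightarrow>\<^sub>0 nat)" where
  "ypart t = Poly_Mapping.map_key Y t"

lemma lookup_xpart [simp]: "Poly_Mapping.lookup (xpart t) c = Poly_Mapping.lookup t (X c)"
  by (simp add: xpart_def map_key.rep_eq inj_X)

lemma lookup_ypart [simp]: "Poly_Mapping.lookup (ypart t) c = Poly_Mapping.lookup t (Y c)"
  by (simp add: ypart_def map_key.rep_eq inj_Y)

lemma monomials_XY_split:
  assumes "t \<in> monomials (X ` N \<union> Y ` N)"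
  shows "Poly_Mapping.keys (xpart t) \<subseteq> N" "Poly_Mapping.keys (ypart t) \<subseteq> N"
    "t = rename_exp X (xpart t) + rename_exp Y (ypart t)"
proof -
  show "Poly_Mapping.keys (xpart t) \<subseteq> N" "Poly_Mapping.keys (ypart t) \<subseteq> N"
    using assms by (auto simp: monomials_def subset_iff in_keys_iff)
  show "t = rename_exp X (xpart t) + rename_exp Y (ypart t)"
  proof (rule poly_mapping_eqI)
    fix v
    have "Poly_Mapping.lookup t (Z c) = 0" for c
      using assms by (auto simp: monomials_def subset_iff in_keys_iff)
    then show "Poly_Mapping.lookup t v = Poly_Mapping.lookup (rename_exp X (xpart t) + rename_exp Y (ypart t)) v"
      by (cases v) (simp_all add: lookup_add)
  qed
qed

lemma monomials_X_rename:
  assumes "t \<in> monomials (X ` N)"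
  obtains u where "Poly_Mapping.keys u \<subseteq> N" "t = rename_exp X u"
proof -
  have t: "t \<in> monomials (X ` N \<union> Y ` N)" using assms by (auto simp: monomials_def)
  have "ypart t = 0"
    using assms by (intro poly_mapping_eqI) (auto simp: monomials_def subset_iff in_keys_iff)
  then show thesis using that monomials_XY_split[OF t] by simp
qed

lemma xpow_add: "xpow (u + v) = (xpow u * xpow v :: (var, 'k::field) mpoly)"
  by (simp add: xpow_def rename_exp_add mon_add)

lemma xpow_zero [simp]: "xpow 0 = 1"
  by (simp add: xpow_def)

lemma pvar_X: "pvar (X c) = xpow (Poly_Mapping.single c 1)"
  by (simp add: pvar_def xpow_def)

lemma keys_xpow [simp]: "Poly_Mapping.keys (xpow u :: (var, 'k::field) mpoly) = {rename_exp X u}"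
  by (simp add: xpow_def)

section \<open>Finite fields, discrete logarithms and coordinates\<close>

text \<open>
  Translation by 1 permutes the field, so adding 1 to all elements does not change their sum.
\<close>

lemma CHAR_of_CARD_prime_power:
  assumes "prime p" "CARD('f::{field, finite}) = p ^ r"
  shows "CHAR('f) = p"
proof -
  have "(\<Sum>x\<in>UNIV. x + 1) = (\<Sum>x\<in>UNIV. x :: 'f)"
    by (rule sum.reindex_bij_witness[of _ "\<lambda>x. x - 1" "\<lambda>x. x + 1"]) auto
  then have "of_nat (CARD('f)) = (0 :: 'f)" by (simp add: sum.distrib)
  then have "of_nat p = (0 :: 'f)" using assms(2) by simp
  then have "CHAR('f) dvd p" by (simp add: of_nat_eq_0_iff_char_dvd)
  moreover have "CHAR('f) \<noteq> 1" using of_nat_CHAR[where ?'a = 'f] by (metis of_nat_1 zero_neq_one)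
  ultimately show ?thesis using assms(1) unfolding prime_nat_iff by metis
qed

text \<open>
  By the pigeonhole principle some power \<open>\<alpha> ^ d\<close> with \<open>1 \<le> d \<le> q - 1\<close> equals 1, so that exponents
  can be reduced modulo \<open>d\<close> into \<open>{1..d}\<close>.  The powers exhaust the \<open>q - 1\<close> nonzero elements, and
  counting gives injectivity.
\<close>

lemma bij_betw_primitive_powers:
  fixes \<alpha> :: "'f::{field, finite}"
  assumes "primitive_element \<alpha>"
  shows "bij_betw (\<lambda>j. \<alpha> ^ j) {1..CARD('f) - 1} (UNIV - {0})"
proof -
  let ?q = "CARD('f)" and ?f = "\<lambda>j::nat. \<alpha> ^ j"
  have range: "range ?f = UNIV - {0}" using assms by (simp add: primitive_element_def)
  have card: "card (UNIV - {0 :: 'f}) = ?q - 1" by (simp add: card_Diff_singleton)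
  have "?q > 0" by (simp add: zero_less_card_finite)
  have nz: "\<alpha> \<noteq> 0" using range by (metis DiffD2 power_one_right rangeI singletonI)
  have "\<not> inj_on ?f {0..?q - 1}"
  proof
    assume "inj_on ?f {0..?q - 1}"
    then have "card {0..?q - 1} \<le> card (UNIV - {0 :: 'f})"
      using range by (intro card_inj_on_le) auto
    moreover have "card {0..?q - 1} = Suc (?q - 1)" by (simp only: card_atLeastAtMost diff_zero)
    ultimately show False using card by linarith
  qed
  then obtain i' j' where "i' \<noteq> j'" "i' \<le> ?q - 1" "j' \<le> ?q - 1" "\<alpha> ^ i' = \<alpha> ^ j'"
    unfolding inj_on_def by auto
  define i j d where "i = min i' j'" and "j = max i' j'" and "d = j - i"
  have ij: "i < j" "j \<le> ?q - 1" "\<alpha> ^ i = \<alpha> ^ j"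
    using \<open>i' \<noteq> j'\<close> \<open>i' \<le> ?q - 1\<close> \<open>j' \<le> ?q - 1\<close> \<open>\<alpha> ^ i' = \<alpha> ^ j'\<close>
    by (auto simp: i_def j_def min_def max_def)
  have "i + d = j" using ij by (simp add: d_def)
  then have "\<alpha> ^ i * \<alpha> ^ d = \<alpha> ^ i * 1" using ij(3) by (metis mult_1_right power_add)
  then have d: "\<alpha> ^ d = 1" using nz by (metis mult_left_cancel power_not_zero)
  have "1 \<le> d" "d \<le> ?q - 1" using ij by (auto simp: d_def)
  have "x \<in> ?f ` {1..?q - 1}" if "x \<noteq> 0" for x
  proof -
    have "x \<in> range ?f" using that range by simp
    then obtain m where "x = \<alpha> ^ m" by auto
    also have "\<dots> = \<alpha> ^ (d * (m div d) + m mod d)" by simp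
    also have "\<dots> = \<alpha> ^ (m mod d)" by (simp only: power_add power_mult d) simp
    also have "\<dots> = \<alpha> ^ (if m mod d = 0 then d else m mod d)" using d by simp
    finally have "x = \<alpha> ^ (if m mod d = 0 then d else m mod d)" .
    moreover have "m mod d \<le> ?q - 1"
      using \<open>1 \<le> d\<close> \<open>d \<le> ?q - 1\<close> mod_less_divisor[of d m] by linarith
    ultimately show ?thesis
      using \<open>1 \<le> d\<close> \<open>d \<le> ?q - 1\<close>
      by (intro image_eqI[of _ _ "if m mod d = 0 then d else m mod d"]) auto
  qed
  then have image: "?f ` {1..?q - 1} = UNIV - {0}" using range by auto
  then have "inj_on ?f {1..?q - 1}" using card by (intro eq_card_imp_inj_on) auto
  then show ?thesis using image by (simp add: bij_betw_def)
qed

lemma of_int_in_prime_subfield [simp]: "of_int z \<in> prime_subfield"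
  by (simp add: prime_subfield_def)

lemma prime_subfield_add: "x \<in> prime_subfield \<Longrightarrow> y \<in> prime_subfield \<Longrightarrow> x + y \<in> prime_subfield"
  by (auto simp: prime_subfield_def simp flip: of_int_add)

lemma prime_subfield_mult: "x \<in> prime_subfield \<Longrightarrow> y \<in> prime_subfield \<Longrightarrow> x * y \<in> prime_subfield"
  by (auto simp: prime_subfield_def simp flip: of_int_mult)

lemma prime_subfield_diff: "x \<in> prime_subfield \<Longrightarrow> y \<in> prime_subfield \<Longrightarrow> x - y \<in> prime_subfield"
  by (auto simp: prime_subfield_def simp flip: of_int_diff)

lemma prime_subfield_sum: "(\<And>i. i \<in> A \<Longrightarrow> f i \<in> prime_subfield) \<Longrightarrow> sum f A \<in> prime_subfield"
  using of_int_in_prime_subfield[of 0]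
  by (induction A rule: infinite_finite_induct) (auto intro: prime_subfield_add)

lemma
  assumes "prime_field_basis r b"
  shows coord_in_prime_subfield: "s < r \<Longrightarrow> coord r b s x \<in> prime_subfield"
    and sum_coord: "(\<Sum>s<r. coord r b s x * b s) = x"
proof -
  obtain c where c: "\<And>s. s < r \<Longrightarrow> c s \<in> prime_subfield" "x = (\<Sum>s<r. c s * b s)"
    using assms unfolding prime_field_basis_def by blast
  have coord: "coord r b s x = c s" if "s < r" for s
    unfolding coord_def
  proof (rule the_equality)
    fix a assume "\<exists>c. (\<forall>t<r. c t \<in> prime_subfield) \<and> x = (\<Sum>t<r. c t * b t) \<and> a = c s"
    then obtain c' where c': "\<And>s. s < r \<Longrightarrow> c' s \<in> prime_subfield" "x = (\<Sum>s<r. c' s * b s)" "a = c' s"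
      by blast
    define d where "d t = c' t - c t" for t
    have "(\<Sum>t<r. d t * b t) = 0"
      using c(2) c'(2) by (simp add: d_def left_diff_distrib sum_subtractf)
    moreover have "\<forall>t<r. d t \<in> prime_subfield"
      using c(1) c'(1) prime_subfield_diff unfolding d_def by blast
    ultimately have "\<forall>t<r. d t = 0"
      using assms unfolding prime_field_basis_def by blast
    then have "c' s - c s = 0" using that by (simp add: d_def)
    then show "a = c s" using c'(3) by simp
  qed (use c in blast)
  show "s < r \<Longrightarrow> coord r b s x \<in> prime_subfield" using coord c by simp
  show "(\<Sum>s<r. coord r b s x * b s) = x" using coord c by simp
qed

text \<open>
  Restricting scalars to the prime field loses nothing: an \<open>\<int>\<close>-linear relation between
  elements of the field is the same thing as \<open>r\<close> relations between their coordinates.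
\<close>

lemma integer_relation_iff_coordinates:
  assumes basis: "prime_field_basis r b"
  shows "(\<Sum>c\<in>A. of_int (m c) * y c) = 0 \<longleftrightarrow> (\<forall>s<r. (\<Sum>c\<in>A. of_int (m c) * coord r b s (y c)) = 0)"
proof -
  define e where "e s = (\<Sum>c\<in>A. of_int (m c) * coord r b s (y c))" for s
  have "(\<Sum>s<r. e s * b s) = (\<Sum>c\<in>A. of_int (m c) * (\<Sum>s<r. coord r b s (y c) * b s))"
    unfolding e_def sum_distrib_left sum_distrib_right by (subst sum.swap) (simp add: mult.assoc)
  then have eq: "(\<Sum>s<r. e s * b s) = (\<Sum>c\<in>A. of_int (m c) * y c)"
    using sum_coord[OF basis] by simp
  have "\<forall>s<r. e s \<in> prime_subfield"
    using coord_in_prime_subfield[OF basis]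
    by (auto simp: e_def intro!: prime_subfield_sum prime_subfield_mult)
  then have "(\<Sum>s<r. e s * b s) = 0 \<longrightarrow> (\<forall>s<r. e s = 0)"
    using basis unfolding prime_field_basis_def by blast
  moreover have "(\<Sum>s<r. e s * b s) = 0" if "\<forall>s<r. e s = 0" using that by simp
  ultimately have "(\<Sum>s<r. e s * b s) = 0 \<longleftrightarrow> (\<forall>s<r. e s = 0)" by blast
  then show ?thesis unfolding eq by (simp only: e_def)
qed

section \<open>Words and syndromes\<close>

locale code_with_check_matrix =
  fixes p r n k :: nat
    and \<alpha> :: "'f::{field, finite}"
    and b :: "nat \<Rightarrow> 'f"
    and C :: "'f vec set"
    and H :: "'f mat"
    and D :: "nat \<times> nat \<Rightarrow> nat \<times> nat \<Rightarrow> int"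
  assumes prime: "prime p" and card: "CARD('f) = p ^ r"
    and primitive: "primitive_element \<alpha>"
    and basis: "prime_field_basis r b"
    and parity: "parity_check_matrix n k C H"
    and lift: "integer_lift ({..<n - k} \<times> {..<r}) (block_idx TYPE('f) n) (H_plus_e \<alpha> r b H) D"
begin

definition "col_idx = block_idx TYPE('f) n"

definition "row_idx = {..<n - k} \<times> {..<r}"

lemma finite_idx [simp]: "finite col_idx" "finite row_idx"
  by (simp_all add: col_idx_def row_idx_def block_idx_def)

lemma col_idx_iff: "(i, j) \<in> col_idx \<longleftrightarrow> i < n \<and> j \<in> {1..CARD('f) - 1}"
  by (simp add: col_idx_def block_idx_def)

text \<open>
  The word \<open>(\<Sum>\<^sub>l u\<^sub>i\<^sub>l \<alpha>\<^sup>l)\<^sub>i\<close> represented by the exponents \<open>u\<close>: modulo the relations in \<open>I_q\<close>,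
  multiplying the variables of one block means adding the corresponding field elements.  The
  crossing map is a section of this map.
\<close>

definition word :: "(nat \<times> nat \<Rightarrow> nat) \<Rightarrow> 'f vec" where
  "word e = vec n (\<lambda>i. \<Sum>l\<in>{1..CARD('f) - 1}. of_nat (e (i, l)) * \<alpha> ^ l)"

definition synd :: "'f vec \<Rightarrow> nat \<Rightarrow> 'f" where
  "synd a = (\<lambda>i. if i < n - k then \<Sum>j<n. a $ j * H $$ (i, j) else 0)"

lemma word_carrier [simp]: "word e \<in> carrier_vec n"
  by (simp add: word_def)

lemma word_add: "word (\<lambda>c. e c + e' c) = word e + word e'"
  by (intro eq_vecI) (simp_all add: word_def distrib_right sum.distrib)

lemma synd_add:
  "a \<in> carrier_vec n \<Longrightarrow> a' \<in> carrier_vec n \<Longrightarrow> synd (a + a') = (\<lambda>i. synd a i + synd a' i)"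
  by (intro ext) (auto simp: synd_def distrib_right sum.distrib)

lemma in_code_iff:
  assumes "c \<in> carrier_vec n"
  shows "c \<in> C \<longleftrightarrow> (\<forall>i<n - k. (\<Sum>j<n. c $ j * H $$ (i, j)) = 0)"
proof -
  have H: "H \<in> carrier_mat (n - k) n" using parity by (simp add: parity_check_matrix_def)
  have "c \<in> C \<longleftrightarrow> mat_of_row c * transpose_mat H = 0\<^sub>m 1 (n - k)"
    using parity assms by (simp add: parity_check_matrix_def)
  also have "\<dots> \<longleftrightarrow> (\<forall>i<n - k. (mat_of_row c * transpose_mat H) $$ (0, i) = 0)"
  proof -
    have "P = 0\<^sub>m 1 (n - k) \<longleftrightarrow> (\<forall>i<n - k. P $$ (0, i) = 0)"
      if "P \<in> carrier_mat 1 (n - k)" for P :: "'f mat"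
      using that by (auto simp: mat_eq_iff)
    moreover have "mat_of_row c * transpose_mat H \<in> carrier_mat 1 (n - k)"
      using assms H by (intro mult_carrier_mat[of _ 1 n]) auto
    ultimately show ?thesis by blast
  qed
  also have "\<dots> \<longleftrightarrow> (\<forall>i<n - k. (\<Sum>j<n. c $ j * H $$ (i, j)) = 0)"
    using assms H by (auto simp: scalar_prod_def mat_of_row_def lessThan_atLeast0)
  finally show ?thesis .
qed

lemma diff_in_code_iff_synd_eq:
  assumes "a \<in> carrier_vec n" "a' \<in> carrier_vec n"
  shows "a - a' \<in> C \<longleftrightarrow> synd a = synd a'"
proof -
  have "a - a' \<in> C \<longleftrightarrow> (\<forall>i<n - k. (\<Sum>j<n. (a - a') $ j * H $$ (i, j)) = 0)"
    using assms by (intro in_code_iff) simp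
  also have "\<dots> \<longleftrightarrow> (\<forall>i<n - k. (\<Sum>j<n. a $ j * H $$ (i, j)) = (\<Sum>j<n. a' $ j * H $$ (i, j)))"
    using assms by (simp add: left_diff_distrib sum_subtractf)
  also have "\<dots> \<longleftrightarrow> synd a = synd a'" by (auto simp: synd_def fun_eq_iff)
  finally show ?thesis .
qed

section \<open>The generalized code ideal\<close>

lemma sum_primitive_powers: "(\<Sum>l\<in>{1..CARD('f) - 1}. if \<alpha> ^ l = x then \<alpha> ^ l else 0) = x"
proof -
  have "(\<Sum>l\<in>{1..CARD('f) - 1}. if \<alpha> ^ l = x then \<alpha> ^ l else 0) = (\<Sum>y\<in>UNIV - {0}. if y = x then y else 0)"
    by (rule sum.reindex_bij_betw[OF bij_betw_primitive_powers[OF primitive]])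
  also have "\<dots> = x" by simp
  finally show ?thesis .
qed

lemma primitive_nonzero [simp]: "\<alpha> \<noteq> 0"
proof -
  have "\<alpha> ^ 1 \<in> range (\<lambda>j::nat. \<alpha> ^ j)" by blast
  then have "\<alpha> ^ 1 \<in> UNIV - {0}" using primitive unfolding primitive_element_def by blast
  then show ?thesis by simp
qed

lemma zero_neq_power [simp]: "0 \<noteq> \<alpha> ^ l"
  using power_not_zero[OF primitive_nonzero] by metis

lemma power_inject:
  "j \<in> {1..CARD('f) - 1} \<Longrightarrow> l \<in> {1..CARD('f) - 1} \<Longrightarrow> \<alpha> ^ j = \<alpha> ^ l \<longleftrightarrow> j = l"
  using bij_betw_primitive_powers[OF primitive] unfolding bij_betw_def inj_on_def by blast

lemma power_exists:
  assumes "x \<noteq> 0"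
  obtains l where "l \<in> {1..CARD('f) - 1}" "x = \<alpha> ^ l"
proof -
  have "x \<in> (\<lambda>j. \<alpha> ^ j) ` {1..CARD('f) - 1}"
    using assms bij_betw_primitive_powers[OF primitive] by (simp add: bij_betw_def)
  then show thesis using that by auto
qed

lemma lookup_crossing:
  assumes "a \<in> carrier_vec n"
  shows "Poly_Mapping.lookup (crossing \<alpha> a) (i, j) = (if (i, j) \<in> col_idx \<and> a $ i = \<alpha> ^ j then 1 else 0)"
proof -
  have "finite {(i, j) \<in> col_idx. a $ i = \<alpha> ^ j}" by (rule finite_subset[of _ col_idx]) auto
  moreover have "crossing \<alpha> a = (\<Sum>c\<in>{(i, j) \<in> col_idx. a $ i = \<alpha> ^ j}. Poly_Mapping.single c 1)"
    using assms unfolding crossing_def col_idx_def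
    by (intro sum.cong) auto
  ultimately show ?thesis by (simp add: lookup_sum lookup_single when_def)
qed

lemma keys_crossing: "a \<in> carrier_vec n \<Longrightarrow> Poly_Mapping.keys (crossing \<alpha> a) \<subseteq> col_idx"
  by (auto simp: in_keys_iff lookup_crossing split: if_splits)

lemma word_crossing:
  assumes "a \<in> carrier_vec n"
  shows "word (Poly_Mapping.lookup (crossing \<alpha> a)) = a"
proof (rule eq_vecI)
  fix i assume i: "i < dim_vec a"
  have "word (Poly_Mapping.lookup (crossing \<alpha> a)) $ i =
      (\<Sum>l\<in>{1..CARD('f) - 1}. if \<alpha> ^ l = a $ i then \<alpha> ^ l else 0)"
    using assms i by (auto simp: word_def lookup_crossing col_idx_iff intro!: sum.cong)
  then show "word (Poly_Mapping.lookup (crossing \<alpha> a)) $ i = a $ i"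
    by (simp only: sum_primitive_powers)
qed (use assms in \<open>simp add: word_def\<close>)

text \<open>
  The degree for which \<open>I_plus\<close> is spanned by differences of monomials of equal degree.
\<close>

definition xsynd :: "(var \<Rightarrow>\<^sub>0 nat) \<Rightarrow> nat \<Rightarrow> 'f" where
  "xsynd t = synd (word (\<lambda>c. Poly_Mapping.lookup t (X c)))"

lemma xsynd_add: "xsynd (s + t) = (\<lambda>i. xsynd s i + xsynd t i)"
  by (simp add: xsynd_def lookup_add word_add synd_add)

lemma xsynd_rename [simp]:
  "xsynd (rename_exp X u) = synd (word (Poly_Mapping.lookup u))"
  "xsynd (rename_exp X u + rename_exp Y v) = synd (word (Poly_Mapping.lookup u))"
  by (simp_all add: xsynd_def lookup_add)

lemma word_single:
  assumes "(i, l) \<in> col_idx"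
  shows "word (Poly_Mapping.lookup (Poly_Mapping.single (i, l) 1)) = vec n (\<lambda>j. if j = i then \<alpha> ^ l else 0)"
proof (rule eq_vecI)
  fix j assume j: "j < dim_vec (vec n (\<lambda>j. if j = i then \<alpha> ^ l else 0))"
  have "of_nat (Poly_Mapping.lookup (Poly_Mapping.single (i, l) 1) (j, l')) * \<alpha> ^ l' =
      (if l' = l then (if j = i then \<alpha> ^ l else 0) else 0)" for l'
    by (auto simp: lookup_single when_def)
  then have "word (Poly_Mapping.lookup (Poly_Mapping.single (i, l) 1)) $ j =
      (\<Sum>l'\<in>{1..CARD('f) - 1}. if l' = l then (if j = i then \<alpha> ^ l else 0) else 0)"
    using j by (simp only: word_def index_vec dim_vec)
  then show "word (Poly_Mapping.lookup (Poly_Mapping.single (i, l) 1)) $ j = vec n (\<lambda>j. if j = i then \<alpha> ^ l else 0) $ j"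
    using assms j by (simp add: col_idx_iff)
qed (simp add: word_def)

lemma word_lookup_add:
  "word (Poly_Mapping.lookup (u + v)) = word (Poly_Mapping.lookup u) + word (Poly_Mapping.lookup v)"
  using word_add[of "Poly_Mapping.lookup u" "Poly_Mapping.lookup v"]
  by (simp add: plus_poly_mapping.rep_eq)

definition I_q_generators :: "(var, 'k::field) mpoly set" where
  "I_q_generators = (\<Union>i<n. {pvar (X (i, u)) * pvar (X (i, v)) - pvar (X (i, w)) | u v w.
               u \<in> {1..CARD('f) - 1} \<and> v \<in> {1..CARD('f) - 1} \<and> w \<in> {1..CARD('f) - 1} \<and>
               \<alpha> ^ u + \<alpha> ^ v = \<alpha> ^ w} \<union>
             {pvar (X (i, u)) * pvar (X (i, v)) - 1 | u v.
               u \<in> {1..CARD('f) - 1} \<and> v \<in> {1..CARD('f) - 1} \<and> \<alpha> ^ u + \<alpha> ^ v = 0})"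

lemma
  assumes "i < n" "u \<in> {1..CARD('f) - 1}" "v \<in> {1..CARD('f) - 1}"
  shows I_q_generators_sum: "w \<in> {1..CARD('f) - 1} \<Longrightarrow> \<alpha> ^ u + \<alpha> ^ v = \<alpha> ^ w \<Longrightarrow>
      pvar (X (i, u)) * pvar (X (i, v)) - pvar (X (i, w)) \<in> (I_q_generators :: (var, 'k::field) mpoly set)"
    and I_q_generators_opposite: "\<alpha> ^ u + \<alpha> ^ v = 0 \<Longrightarrow>
      pvar (X (i, u)) * pvar (X (i, v)) - 1 \<in> (I_q_generators :: (var, 'k) mpoly set)"
  using assms unfolding I_q_generators_def by blast+

lemma I_q_eq: "(I_q \<alpha> n :: (var, 'k::field) mpoly set) = genideal (mpoly_ring (X ` col_idx)) I_q_generators"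
  by (simp add: I_q_def I_q_generators_def col_idx_def)

definition code_binomials :: "(var, 'k::field) mpoly set" where
  "code_binomials = {xpow (crossing \<alpha> a) - xpow (crossing \<alpha> b) | a b.
     a \<in> carrier_vec n \<and> b \<in> carrier_vec n \<and> a - b \<in> C}"

lemma I_plus_eq: "(I_plus \<alpha> n C :: (var, 'k::field) mpoly set) =
  set_add (mpoly_ring (X ` col_idx)) (genideal (mpoly_ring (X ` col_idx)) code_binomials) (I_q \<alpha> n)"
  by (simp add: I_plus_def code_binomials_def col_idx_def)

lemma xpow_diff_in_kernel:
  assumes "Poly_Mapping.keys u \<subseteq> col_idx" "Poly_Mapping.keys v \<subseteq> col_idx"
    "synd (word (Poly_Mapping.lookup u)) = synd (word (Poly_Mapping.lookup v))"
  shows "xpow u - xpow v \<in> {f :: (var, 'k::field) mpoly. Poly_Mapping.keys f \<subseteq> monomials (X ` col_idx) \<and> regrade xsynd f = 0}"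
proof -
  have "Poly_Mapping.keys (xpow u - xpow v :: (var, 'k) mpoly) \<subseteq> {rename_exp X u, rename_exp X v}"
    using keys_diff[of "xpow u :: (var, 'k) mpoly" "xpow v"] by auto
  then have "Poly_Mapping.keys (xpow u - xpow v :: (var, 'k) mpoly) \<subseteq> monomials (X ` col_idx)"
    using assms by (auto simp: subset_iff)
  moreover have "regrade xsynd (xpow u - xpow v :: (var, 'k) mpoly) = 0"
    using assms(3) by (simp add: regrade_diff xpow_def)
  ultimately show ?thesis by simp
qed

lemma I_q_generators_in_kernel:
  "I_q_generators \<subseteq> {f :: (var, 'k::field) mpoly. Poly_Mapping.keys f \<subseteq> monomials (X ` col_idx) \<and> regrade xsynd f = 0}"
proof
  fix f :: "(var, 'k) mpoly" assume "f \<in> I_q_generators"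
  then consider (sum) i u v w where "i < n" "u \<in> {1..CARD('f) - 1}" "v \<in> {1..CARD('f) - 1}" "w \<in> {1..CARD('f) - 1}"
      "\<alpha> ^ u + \<alpha> ^ v = \<alpha> ^ w" "f = pvar (X (i, u)) * pvar (X (i, v)) - pvar (X (i, w))"
    | (opposite) i u v where "i < n" "u \<in> {1..CARD('f) - 1}" "v \<in> {1..CARD('f) - 1}"
      "\<alpha> ^ u + \<alpha> ^ v = 0" "f = pvar (X (i, u)) * pvar (X (i, v)) - 1"
    unfolding I_q_generators_def by blast
  then show "f \<in> {f. Poly_Mapping.keys f \<subseteq> monomials (X ` col_idx) \<and> regrade xsynd f = 0}"
  proof cases
    case sum
    then have c: "(i, u) \<in> col_idx" "(i, v) \<in> col_idx" "(i, w) \<in> col_idx" by (simp_all add: col_idx_iff)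
    have "f = xpow (Poly_Mapping.single (i, u) 1 + Poly_Mapping.single (i, v) 1) - xpow (Poly_Mapping.single (i, w) 1)"
      using sum by (simp add: xpow_add pvar_X)
    moreover have "word (Poly_Mapping.lookup (Poly_Mapping.single (i, u) 1 + Poly_Mapping.single (i, v) 1)) =
        word (Poly_Mapping.lookup (Poly_Mapping.single (i, w) 1))"
      unfolding word_lookup_add word_single[OF c(1)] word_single[OF c(2)] word_single[OF c(3)]
      by (intro eq_vecI) (use sum in auto)
    ultimately show ?thesis
      using c Poly_Mapping.keys_add[of "Poly_Mapping.single (i, u) 1" "Poly_Mapping.single (i, v) (1::nat)"]
      by (simp only:) (intro xpow_diff_in_kernel, auto)
  next
    case opposite
    then have c: "(i, u) \<in> col_idx" "(i, v) \<in> col_idx" by (simp_all add: col_idx_iff)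
    have "f = xpow (Poly_Mapping.single (i, u) 1 + Poly_Mapping.single (i, v) 1) - xpow 0"
      using opposite by (simp add: xpow_add pvar_X)
    moreover have "word (Poly_Mapping.lookup (Poly_Mapping.single (i, u) 1 + Poly_Mapping.single (i, v) 1)) =
        word (Poly_Mapping.lookup 0)"
      unfolding word_lookup_add word_single[OF c(1)] word_single[OF c(2)]
      by (intro eq_vecI) (use opposite in \<open>auto simp: word_def\<close>)
    ultimately show ?thesis
      using c Poly_Mapping.keys_add[of "Poly_Mapping.single (i, u) 1" "Poly_Mapping.single (i, v) (1::nat)"]
      by (simp only:) (intro xpow_diff_in_kernel, auto)
  qed
qed

lemma code_binomials_in_kernel:
  "code_binomials \<subseteq> {f :: (var, 'k::field) mpoly. Poly_Mapping.keys f \<subseteq> monomials (X ` col_idx) \<and> regrade xsynd f = 0}"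
proof
  fix f :: "(var, 'k) mpoly" assume "f \<in> code_binomials"
  then obtain a b where ab: "a \<in> carrier_vec n" "b \<in> carrier_vec n" "a - b \<in> C"
    "f = xpow (crossing \<alpha> a) - xpow (crossing \<alpha> b)"
    unfolding code_binomials_def by blast
  then show "f \<in> {f. Poly_Mapping.keys f \<subseteq> monomials (X ` col_idx) \<and> regrade xsynd f = 0}"
    unfolding ab(4) by (intro xpow_diff_in_kernel) (simp_all add: keys_crossing word_crossing diff_in_code_iff_synd_eq)
qed

lemma ideal_xsynd_kernel:
  "ideal {f :: (var, 'k::field) mpoly. Poly_Mapping.keys f \<subseteq> monomials V \<and> regrade xsynd f = 0} (mpoly_ring V)"
  by (rule ideal_kernel_regrade) (simp add: xsynd_add fun_eq_iff)

lemma I_plus_in_kernel: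
  assumes "f \<in> (I_plus \<alpha> n C :: (var, 'k::field) mpoly set)"
  shows "Poly_Mapping.keys f \<subseteq> monomials (X ` col_idx)" "regrade xsynd f = 0"
proof -
  let ?J = "{f :: (var, 'k) mpoly. Poly_Mapping.keys f \<subseteq> monomials (X ` col_idx) \<and> regrade xsynd f = 0}"
  have "genideal (mpoly_ring (X ` col_idx)) code_binomials \<subseteq> ?J"
    by (rule ring.genideal_minimal[OF ring_mpoly_ring ideal_xsynd_kernel code_binomials_in_kernel])
  moreover have "I_q \<alpha> n \<subseteq> ?J" unfolding I_q_eq
    by (rule ring.genideal_minimal[OF ring_mpoly_ring ideal_xsynd_kernel I_q_generators_in_kernel])
  moreover obtain g h where "g \<in> genideal (mpoly_ring (X ` col_idx)) code_binomials" "h \<in> I_q \<alpha> n" "f = g + h"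
    using assms unfolding I_plus_eq set_add_def set_mult_def by auto
  ultimately have "f \<in> ?J" using ideal_mpoly_ring_add[OF ideal_xsynd_kernel] by blast
  then show "Poly_Mapping.keys f \<subseteq> monomials (X ` col_idx)" "regrade xsynd f = 0" by auto
qed

lemma
  shows ideal_I_q: "ideal (I_q \<alpha> n :: (var, 'k::field) mpoly set) (mpoly_ring (X ` col_idx))"
    and I_q_generators_subset: "(I_q_generators :: (var, 'k) mpoly set) \<subseteq> I_q \<alpha> n"
    and code_binomials_subset: "(code_binomials :: (var, 'k) mpoly set) \<subseteq> genideal (mpoly_ring (X ` col_idx)) code_binomials"
proof -
  have "(I_q_generators :: (var, 'k) mpoly set) \<subseteq> carrier (mpoly_ring (X ` col_idx))"
    using I_q_generators_in_kernel by auto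
  then show "ideal (I_q \<alpha> n :: (var, 'k) mpoly set) (mpoly_ring (X ` col_idx))" "(I_q_generators :: (var, 'k) mpoly set) \<subseteq> I_q \<alpha> n"
    unfolding I_q_eq
    by (rule ring.genideal_ideal[OF ring_mpoly_ring], rule ring.genideal_self[OF ring_mpoly_ring])
  have "(code_binomials :: (var, 'k) mpoly set) \<subseteq> carrier (mpoly_ring (X ` col_idx))"
    using code_binomials_in_kernel by auto
  then show "(code_binomials :: (var, 'k) mpoly set) \<subseteq> genideal (mpoly_ring (X ` col_idx)) code_binomials"
    by (rule ring.genideal_self[OF ring_mpoly_ring])
qed

text \<open>
  The contribution of a single coordinate to the crossing map: the variable \<open>x\<^sub>i\<^sub>l\<close> if
  \<open>x = \<alpha>\<^sup>l\<close>, and the monomial 1 if \<open>x = 0\<close>.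
\<close>

definition block_exp :: "nat \<Rightarrow> 'f \<Rightarrow> (nat \<times> nat \<Rightarrow>\<^sub>0 nat)" where
  "block_exp i x = crossing \<alpha> (vec n (\<lambda>j. if j = i then x else 0))"

lemma block_exp_zero [simp]: "block_exp i 0 = 0"
proof (rule poly_mapping_eqI)
  fix c :: "nat \<times> nat"
  obtain i' j where c: "c = (i', j)" by (cases c)
  show "Poly_Mapping.lookup (block_exp i 0) c = Poly_Mapping.lookup 0 c"
    by (auto simp: c block_exp_def lookup_crossing col_idx_iff)
qed

lemma block_exp_power:
  assumes "(i, l) \<in> col_idx"
  shows "block_exp i (\<alpha> ^ l) = Poly_Mapping.single (i, l) 1"
proof (rule poly_mapping_eqI)
  fix c :: "nat \<times> nat"
  obtain i' j where c: "c = (i', j)" by (cases c)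
  show "Poly_Mapping.lookup (block_exp i (\<alpha> ^ l)) c = Poly_Mapping.lookup (Poly_Mapping.single (i, l) 1) c"
    using assms power_inject[of l j]
    by (auto simp: c block_exp_def lookup_crossing col_idx_iff lookup_single when_def split: if_splits)
qed

lemma crossing_split:
  assumes "a \<in> carrier_vec n" "i < n"
  shows "crossing \<alpha> a = crossing \<alpha> (vec n (\<lambda>j. if j = i then 0 else a $ j)) + block_exp i (a $ i)"
proof (rule poly_mapping_eqI)
  fix c :: "nat \<times> nat"
  obtain i' j where c: "c = (i', j)" by (cases c)
  show "Poly_Mapping.lookup (crossing \<alpha> a) c = Poly_Mapping.lookup
      (crossing \<alpha> (vec n (\<lambda>j. if j = i then 0 else a $ j)) + block_exp i (a $ i)) c"
    using assms
    by (auto simp: c block_exp_def lookup_crossing col_idx_iff lookup_add)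
qed

text \<open>
  Multiplication by \<open>x\<^sub>i\<^sub>l\<close> changes only block \<open>i\<close> of the crossing map.  If that block is empty
  nothing has to be shown; otherwise the product of two variables of the block is, modulo one
  of the generators of \<open>I_q\<close>, the variable of the sum of the two field elements, or 1 if the
  sum vanishes.
\<close>

lemma add_unit_in_I_q:
  assumes "a \<in> carrier_vec n" "(i, l) \<in> col_idx"
  shows "xpow (Poly_Mapping.single (i, l) 1) * xpow (crossing \<alpha> a) -
    xpow (crossing \<alpha> (a + vec n (\<lambda>j. if j = i then \<alpha> ^ l else 0))) \<in> (I_q \<alpha> n :: (var, 'k::field) mpoly set)"
proof -
  let ?a' = "a + vec n (\<lambda>j. if j = i then \<alpha> ^ l else 0)"
  define rest where "rest = crossing \<alpha> (vec n (\<lambda>j. if j = i then 0 else a $ j))"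
  have i: "i < n" and l: "l \<in> {1..CARD('f) - 1}" using assms by (simp_all add: col_idx_iff)
  have "vec n (\<lambda>j. if j = i then 0 else ?a' $ j) = vec n (\<lambda>j. if j = i then 0 else a $ j)"
    using assms by (intro eq_vecI) auto
  then have cross: "crossing \<alpha> a = rest + block_exp i (a $ i)" "crossing \<alpha> ?a' = rest + block_exp i (a $ i + \<alpha> ^ l)"
    using crossing_split[OF assms(1) i] crossing_split[of ?a' i] i assms(1) by (simp_all add: rest_def)
  have "xpow (Poly_Mapping.single (i, l) 1) * xpow (block_exp i (a $ i)) - xpow (block_exp i (a $ i + \<alpha> ^ l))
      \<in> (I_q \<alpha> n :: (var, 'k) mpoly set)"
  proof (cases "a $ i = 0")
    case True
    then show ?thesis
      using ideal_mpoly_ring_zero[OF ideal_I_q] by (simp add: block_exp_power[OF assms(2)])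
  next
    case False
    then obtain j where j: "j \<in> {1..CARD('f) - 1}" "a $ i = \<alpha> ^ j" by (rule power_exists)
    have ij: "(i, j) \<in> col_idx" using j i by (simp add: col_idx_iff)
    have blk: "block_exp i (a $ i) = Poly_Mapping.single (i, j) 1"
      unfolding j(2) by (rule block_exp_power[OF ij])
    have "xpow (Poly_Mapping.single (i, l) 1) * xpow (block_exp i (a $ i)) - xpow (block_exp i (a $ i + \<alpha> ^ l))
        \<in> (I_q_generators :: (var, 'k) mpoly set)"
    proof (cases "a $ i + \<alpha> ^ l = 0")
      case True
      then have "\<alpha> ^ l + \<alpha> ^ j = 0" using j by (simp add: add.commute)
      from I_q_generators_opposite[OF i l j(1) this] show ?thesis
        by (simp only: True block_exp_zero xpow_zero blk pvar_X)
    next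
      case False
      then obtain w where w: "w \<in> {1..CARD('f) - 1}" "a $ i + \<alpha> ^ l = \<alpha> ^ w" by (rule power_exists)
      have iw: "(i, w) \<in> col_idx" using w i by (simp add: col_idx_iff)
      have "\<alpha> ^ l + \<alpha> ^ j = \<alpha> ^ w" using j w by (simp add: add.commute)
      from I_q_generators_sum[OF i l j(1) w(1) this] show ?thesis
        by (simp only: w(2) block_exp_power[OF iw] blk pvar_X)
    qed
    then show ?thesis using I_q_generators_subset by blast
  qed
  then have "xpow rest * (xpow (Poly_Mapping.single (i, l) 1) * xpow (block_exp i (a $ i)) - xpow (block_exp i (a $ i + \<alpha> ^ l)))
      \<in> (I_q \<alpha> n :: (var, 'k) mpoly set)"
    by (rule ideal_mpoly_ring_mult[OF ideal_I_q]) (simp add: rest_def keys_crossing)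
  then show ?thesis by (simp add: cross xpow_add algebra_simps)
qed

text \<open>
  Every monomial is congruent modulo \<open>I_q\<close> to the squarefree monomial of the word it represents;
  the variables are absorbed one at a time.
\<close>

lemma xpow_minus_crossing_in_I_q:
  "Poly_Mapping.keys u \<subseteq> col_idx \<Longrightarrow>
    xpow u - xpow (crossing \<alpha> (word (Poly_Mapping.lookup u))) \<in> (I_q \<alpha> n :: (var, 'k::field) mpoly set)"
proof (induction "\<Sum>c\<in>col_idx. Poly_Mapping.lookup u c" arbitrary: u)
  case 0
  have "Poly_Mapping.lookup u c = 0" for c
  proof (cases "c \<in> col_idx")
    case False
    then show ?thesis using 0(2) in_keys_iff[of c u] by blast
  qed (use 0(1) in simp)
  then have u: "u = 0" by (intro poly_mapping_eqI) simp
  have "word (Poly_Mapping.lookup 0) = vec n (\<lambda>j. if j = 0 then 0 else 0)" by (intro eq_vecI) (simp_all add: word_def)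
  then have "crossing \<alpha> (word (Poly_Mapping.lookup u)) = 0"
    using block_exp_zero[of 0] u by (simp add: block_exp_def)
  then have "xpow u - xpow (crossing \<alpha> (word (Poly_Mapping.lookup u))) = (0 :: (var, 'k) mpoly)"
    by (simp only:) (simp add: u)
  then show ?case using ideal_mpoly_ring_zero[OF ideal_I_q] by metis
next
  case (Suc d)
  then have "u \<noteq> 0" by auto
  then obtain i l where il: "(i, l) \<in> Poly_Mapping.keys u" by (metis keys_eq_empty all_not_in_conv surj_pair)
  define e where "e = Poly_Mapping.single (i, l) (1::nat)"
  define u' where "u' = u - e"
  have u: "u = u' + e"
    using il by (intro poly_mapping_eqI) (auto simp: u'_def e_def lookup_add lookup_minus lookup_single when_def in_keys_iff)
  have c: "(i, l) \<in> col_idx" using il Suc.prems by blast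
  have u': "Poly_Mapping.keys u' \<subseteq> col_idx"
    using Suc.prems by (auto simp: u in_keys_iff lookup_add subset_iff)
  have "Suc d = (\<Sum>c\<in>col_idx. Poly_Mapping.lookup u' c) + (\<Sum>c\<in>col_idx. Poly_Mapping.lookup e c)"
    using Suc.hyps(2) by (simp add: u lookup_add sum.distrib)
  also have "(\<Sum>c\<in>col_idx. Poly_Mapping.lookup e c) = 1" using c by (simp add: e_def lookup_single when_def)
  finally have IH: "xpow u' - xpow (crossing \<alpha> (word (Poly_Mapping.lookup u'))) \<in> (I_q \<alpha> n :: (var, 'k) mpoly set)"
    using Suc.hyps(1)[OF _ u'] by simp
  have "xpow e * (xpow u' - xpow (crossing \<alpha> (word (Poly_Mapping.lookup u')))) \<in> (I_q \<alpha> n :: (var, 'k) mpoly set)"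
    by (rule ideal_mpoly_ring_mult[OF ideal_I_q IH]) (use c in \<open>simp add: e_def monomials_def\<close>)
  moreover have "xpow e * xpow (crossing \<alpha> (word (Poly_Mapping.lookup u'))) -
      xpow (crossing \<alpha> (word (Poly_Mapping.lookup u))) \<in> (I_q \<alpha> n :: (var, 'k) mpoly set)"
    using add_unit_in_I_q[OF _ c, of "word (Poly_Mapping.lookup u')"] word_single[OF c]
    by (simp add: u word_lookup_add e_def)
  ultimately have "xpow e * (xpow u' - xpow (crossing \<alpha> (word (Poly_Mapping.lookup u')))) +
      (xpow e * xpow (crossing \<alpha> (word (Poly_Mapping.lookup u'))) - xpow (crossing \<alpha> (word (Poly_Mapping.lookup u))))
      \<in> (I_q \<alpha> n :: (var, 'k) mpoly set)"
    by (rule ideal_mpoly_ring_add[OF ideal_I_q])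
  then show ?case by (simp add: u xpow_add algebra_simps)
qed

lemma add_in_set_add:
  "g \<in> A \<Longrightarrow> h \<in> B \<Longrightarrow> g + h \<in> set_add (mpoly_ring V) A B"
  by (auto simp: set_add_def set_mult_def)

text \<open>
  Membership forces equal syndromes because all generators lie in the kernel of the regrading by
  syndromes.  Conversely, both monomials may be replaced by crossing monomials modulo \<open>I_q\<close>,
  and these differ by a generator since the two words differ by a codeword.
\<close>

lemma binomial_in_I_plus_iff:
  assumes "u \<noteq> v"
  shows "(mon u - mon v :: (var, 'k::field) mpoly) \<in> I_plus \<alpha> n C \<longleftrightarrow>
    u \<in> monomials (X ` col_idx) \<and> v \<in> monomials (X ` col_idx) \<and> xsynd u = xsynd v"
proof
  assume l: "(mon u - mon v :: (var, 'k) mpoly) \<in> I_plus \<alpha> n C"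
  have "regrade xsynd (mon u - mon v :: (var, 'k) mpoly) = 0" using I_plus_in_kernel[OF l] by simp
  then have "Poly_Mapping.single (xsynd u) (1::'k) = Poly_Mapping.single (xsynd v) 1" by (simp add: regrade_diff)
  then have "xsynd u = xsynd v" by (metis keys_single singleton_inject zero_neq_one)
  then show "u \<in> monomials (X ` col_idx) \<and> v \<in> monomials (X ` col_idx) \<and> xsynd u = xsynd v"
    using I_plus_in_kernel(1)[OF l] keys_mon_diff[OF assms, where ?'k = 'k] by auto
next
  assume r: "u \<in> monomials (X ` col_idx) \<and> v \<in> monomials (X ` col_idx) \<and> xsynd u = xsynd v"
  obtain u' v' where uv: "Poly_Mapping.keys u' \<subseteq> col_idx" "u = rename_exp X u'"
    "Poly_Mapping.keys v' \<subseteq> col_idx" "v = rename_exp X v'"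
    using r monomials_X_rename by metis
  define a c where "a = word (Poly_Mapping.lookup u')" and "c = word (Poly_Mapping.lookup v')"
  have ac: "a \<in> carrier_vec n" "c \<in> carrier_vec n" by (simp_all add: a_def c_def)
  have "a - c \<in> C" unfolding diff_in_code_iff_synd_eq[OF ac] using r by (simp add: uv a_def c_def)
  then have "(xpow (crossing \<alpha> a) - xpow (crossing \<alpha> c) :: (var, 'k) mpoly) \<in> genideal (mpoly_ring (X ` col_idx)) code_binomials"
    using code_binomials_subset ac unfolding code_binomials_def by blast
  moreover have "(xpow u' - xpow (crossing \<alpha> a)) - (xpow v' - xpow (crossing \<alpha> c)) \<in> (I_q \<alpha> n :: (var, 'k) mpoly set)"
    unfolding a_def c_def using xpow_minus_crossing_in_I_q uv
    by (intro ideal_mpoly_ring_diff[OF ideal_I_q, of "_ - _" "_ - _"]) auto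
  moreover have "(mon u - mon v :: (var, 'k) mpoly) = (xpow (crossing \<alpha> a) - xpow (crossing \<alpha> c)) +
      ((xpow u' - xpow (crossing \<alpha> a)) - (xpow v' - xpow (crossing \<alpha> c)))"
    by (simp add: uv xpow_def)
  ultimately show "(mon u - mon v :: (var, 'k) mpoly) \<in> I_plus \<alpha> n C"
    unfolding I_plus_eq by (simp only: add_in_set_add)
qed

end

section \<open>The ideal of the p-Lawrence lifting\<close>

lemma keys_regrade: "Poly_Mapping.keys (regrade \<psi> f) \<subseteq> \<psi> ` Poly_Mapping.keys f"
  unfolding regrade_def by (rule order_trans[OF keys_sum]) auto

definition drop_z :: "(var \<Rightarrow>\<^sub>0 nat) \<Rightarrow> (var \<Rightarrow>\<^sub>0 nat)" where
  "drop_z t = (\<Sum>v\<in>Poly_Mapping.keys t. case v of Z _ \<Rightarrow> 0 | _ \<Rightarrow> Poly_Mapping.single v (Poly_Mapping.lookup t v))"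

lemma lookup_drop_z:
  "Poly_Mapping.lookup (drop_z t) v = (case v of Z _ \<Rightarrow> 0 | _ \<Rightarrow> Poly_Mapping.lookup t v)"
proof -
  have "Poly_Mapping.lookup (drop_z t) v = (\<Sum>w\<in>Poly_Mapping.keys t.
      if w = v then (case v of Z _ \<Rightarrow> 0 | _ \<Rightarrow> Poly_Mapping.lookup t v) else 0)"
    unfolding drop_z_def lookup_sum
    by (intro sum.cong) (auto simp: lookup_single when_def split: var.splits)
  then show ?thesis by (auto simp: in_keys_iff split: var.splits)
qed

lemma mon_sum: "mon (sum f A) = (\<Prod>a\<in>A. mon (f a) :: ('v, 'k::comm_ring_1) mpoly)"
  by (induction A rule: infinite_finite_induct) (simp_all add: mon_add)

lemma z_to_one_power:
  "(z_to_one v ^ m :: (var, 'k::field) mpoly) = mon (case v of Z _ \<Rightarrow> 0 | _ \<Rightarrow> Poly_Mapping.single v m)"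
proof (cases "\<exists>c. v = Z c")
  case True
  then show ?thesis by (auto simp: z_to_one_def)
next
  case False
  have "(pvar v ^ m :: (var, 'k) mpoly) = mon (Poly_Mapping.single v m)"
    by (induction m) (simp_all add: pvar_def flip: mon_add single_add)
  then show ?thesis using False by (auto simp: z_to_one_def split: var.splits)
qed

lemma psubst_z_to_one: "psubst z_to_one f = regrade drop_z (f :: (var, 'k::field) mpoly)"
  unfolding psubst_def regrade_def z_to_one_power
  by (simp add: drop_z_def mult_single mon_def flip: mon_sum[unfolded mon_def])

context code_with_check_matrix
begin

lemma sum_lawrence_columns:
  "(\<Sum>v\<in>X ` col_idx \<union> Y ` col_idx \<union> Z ` row_idx. g v) =
    (\<Sum>c\<in>col_idx. g (X c)) + (\<Sum>c\<in>col_idx. g (Y c)) + (\<Sum>i\<in>row_idx. g (Z i))"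
proof -
  have "(\<Sum>v\<in>X ` col_idx \<union> Y ` col_idx \<union> Z ` row_idx. g v) =
      (\<Sum>v\<in>X ` col_idx. g v) + (\<Sum>v\<in>Y ` col_idx. g v) + (\<Sum>v\<in>Z ` row_idx. g v)"
    by (subst sum.union_disjoint; (subst sum.union_disjoint)?) auto
  then show ?thesis by (simp add: sum.reindex inj_on_def)
qed

lemma lawrence_row_upper:
  assumes "i \<in> row_idx"
  shows "(\<Sum>v\<in>X ` col_idx \<union> Y ` col_idx \<union> Z ` row_idx. lawrence_lifting p D (Inl i) v * int (Poly_Mapping.lookup t v)) =
    (\<Sum>c\<in>col_idx. D i c * int (Poly_Mapping.lookup t (X c))) + int p * int (Poly_Mapping.lookup t (Z i))"
proof -
  have "(\<Sum>i'\<in>row_idx. (if i = i' then int p else 0) * int (Poly_Mapping.lookup t (Z i'))) =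
      (\<Sum>i'\<in>row_idx. if i = i' then int p * int (Poly_Mapping.lookup t (Z i')) else 0)"
    by (intro sum.cong) auto
  then show ?thesis using assms by (simp add: sum_lawrence_columns)
qed

lemma lawrence_row_lower:
  assumes "d \<in> col_idx"
  shows "(\<Sum>v\<in>X ` col_idx \<union> Y ` col_idx \<union> Z ` row_idx. lawrence_lifting p D (Inr d) v * int (Poly_Mapping.lookup t v)) =
    int (Poly_Mapping.lookup t (X d)) + int (Poly_Mapping.lookup t (Y d))"
proof -
  have "(\<Sum>c\<in>col_idx. (if d = c then 1 else 0) * int (Poly_Mapping.lookup t (F c))) =
      (\<Sum>c\<in>col_idx. if d = c then int (Poly_Mapping.lookup t (F c)) else 0)" for F
    by (intro sum.cong) auto
  then show ?thesis using assms by (simp add: sum_lawrence_columns)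
qed

lemma xsynd_as_sum:
  assumes "i < n - k"
  shows "xsynd t i = (\<Sum>c\<in>col_idx. of_nat (Poly_Mapping.lookup t (X c)) * (\<alpha> ^ snd c * H $$ (i, fst c)))"
proof -
  have "xsynd t i = (\<Sum>j<n. \<Sum>l\<in>{1..CARD('f) - 1}. of_nat (Poly_Mapping.lookup t (X (j, l))) * (\<alpha> ^ l * H $$ (i, j)))"
    unfolding xsynd_def synd_def word_def using assms
    by (simp add: sum_distrib_right mult.assoc)
  also have "\<dots> = (\<Sum>(j, l)\<in>col_idx. of_nat (Poly_Mapping.lookup t (X (j, l))) * (\<alpha> ^ l * H $$ (i, j)))"
    by (simp add: sum.cartesian_product col_idx_def block_idx_def)
  also have "\<dots> = (\<Sum>c\<in>col_idx. of_nat (Poly_Mapping.lookup t (X c)) * (\<alpha> ^ snd c * H $$ (i, fst c)))"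
    by (intro sum.cong) auto
  finally show ?thesis .
qed

text \<open>
  The rows of the integer lift belonging to row \<open>i\<close> of the check matrix are the coordinates over
  the prime field of the \<open>i\<close>-th syndrome entry, and an integer vanishes in the field if and only
  if it is divisible by the characteristic \<open>p\<close>.
\<close>

lemma xsynd_eq_iff_dvd:
  "xsynd s = xsynd t \<longleftrightarrow> (\<forall>i\<in>row_idx. int p dvd
    (\<Sum>c\<in>col_idx. D i c * (int (Poly_Mapping.lookup s (X c)) - int (Poly_Mapping.lookup t (X c)))))"
proof -
  define m where "m c = int (Poly_Mapping.lookup s (X c)) - int (Poly_Mapping.lookup t (X c))" for c
  have "xsynd s i = xsynd t i \<longleftrightarrow> (\<forall>e<r. int p dvd (\<Sum>c\<in>col_idx. D (i, e) c * m c))" if i: "i < n - k" for i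
  proof -
    let ?y = "\<lambda>c. \<alpha> ^ snd c * H $$ (i, fst c)"
    have "xsynd s i - xsynd t i = (\<Sum>c\<in>col_idx. of_int (m c) * ?y c)"
      by (simp add: xsynd_as_sum[OF i] m_def left_diff_distrib sum_subtractf)
    then have "xsynd s i = xsynd t i \<longleftrightarrow> (\<Sum>c\<in>col_idx. of_int (m c) * ?y c) = 0"
      by (metis right_minus_eq)
    also have "\<dots> \<longleftrightarrow> (\<forall>e<r. (\<Sum>c\<in>col_idx. of_int (m c) * coord r b e (?y c)) = 0)"
      by (rule integer_relation_iff_coordinates[OF basis])
    also have "\<dots> \<longleftrightarrow> (\<forall>e<r. int p dvd (\<Sum>c\<in>col_idx. D (i, e) c * m c))"
    proof -
      have "(\<Sum>c\<in>col_idx. of_int (m c) * coord r b e (?y c)) = of_int (\<Sum>c\<in>col_idx. D (i, e) c * m c)"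
        if "e < r" for e
      proof -
        have "coord r b e (?y c) = of_int (D (i, e) c)" if "c \<in> col_idx" for c
        proof -
          have "of_int (D (i, e) c) = H_plus_e \<alpha> r b H (i, e) c"
            using lift that \<open>e < r\<close> i unfolding integer_lift_def col_idx_def by auto
          then show ?thesis by (simp add: H_plus_e_def case_prod_beta)
        qed
        then show ?thesis by (simp add: mult.commute)
      qed
      then show ?thesis
        by (simp add: of_int_eq_0_iff_char_dvd CHAR_of_CARD_prime_power[OF prime card] del: of_int_sum)
    qed
    finally show ?thesis .
  qed
  moreover have "xsynd s = xsynd t \<longleftrightarrow> (\<forall>i<n - k. xsynd s i = xsynd t i)"
    by (auto simp: fun_eq_iff xsynd_def synd_def)
  ultimately show ?thesis unfolding m_def by (auto simp: row_idx_def)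
qed

text \<open>
  The degree for which \<open>I_Lambda\<close> is spanned by differences of monomials of equal degree: the
  first component comes from the lower rows of the Lawrence lifting, the second one is what its
  upper rows say when \<open>z\<close> is arbitrary.  The first component vanishes outside the column indices,
  so that equality of degrees concerns the actual variables only.
\<close>

definition lawrence_degree :: "(var \<Rightarrow>\<^sub>0 nat) \<Rightarrow> (nat \<times> nat \<Rightarrow> nat) \<times> (nat \<Rightarrow> 'f)" where
  "lawrence_degree t =
    (\<lambda>c. if c \<in> col_idx then Poly_Mapping.lookup t (X c) + Poly_Mapping.lookup t (Y c) else 0, xsynd t)"

lemma lawrence_degree_cancel:
  "lawrence_degree (w + s) = lawrence_degree (w + t) \<longleftrightarrow> lawrence_degree s = lawrence_degree t"
proof -
  have "(\<lambda>c. if c \<in> col_idx then Poly_Mapping.lookup (w + s) (X c) + Poly_Mapping.lookup (w + s) (Y c) else 0) =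
      (\<lambda>c. if c \<in> col_idx then Poly_Mapping.lookup (w + t) (X c) + Poly_Mapping.lookup (w + t) (Y c) else 0) \<longleftrightarrow>
      (\<lambda>c. if c \<in> col_idx then Poly_Mapping.lookup s (X c) + Poly_Mapping.lookup s (Y c) else 0) =
      (\<lambda>c. if c \<in> col_idx then Poly_Mapping.lookup t (X c) + Poly_Mapping.lookup t (Y c) else 0)"
    unfolding fun_eq_iff by (intro all_cong1) (simp add: lookup_add)
  then show ?thesis by (simp add: lawrence_degree_def xsynd_add fun_eq_iff)
qed

lemma lawrence_degree_drop_z: "lawrence_degree (drop_z t) = lawrence_degree t"
  by (auto simp: lawrence_degree_def lookup_drop_z xsynd_def fun_eq_iff)

lemma lawrence_degree_eq_if_rows_eq:
  assumes "\<forall>i\<in>Inl ` row_idx \<union> Inr ` col_idx.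
    (\<Sum>v\<in>X ` col_idx \<union> Y ` col_idx \<union> Z ` row_idx. lawrence_lifting p D i v * int (Poly_Mapping.lookup s v)) =
    (\<Sum>v\<in>X ` col_idx \<union> Y ` col_idx \<union> Z ` row_idx. lawrence_lifting p D i v * int (Poly_Mapping.lookup t v))"
  shows "lawrence_degree s = lawrence_degree t"
proof -
  have "int p dvd (\<Sum>c\<in>col_idx. D i c * (int (Poly_Mapping.lookup s (X c)) - int (Poly_Mapping.lookup t (X c))))"
    if i: "i \<in> row_idx" for i
  proof
    show "(\<Sum>c\<in>col_idx. D i c * (int (Poly_Mapping.lookup s (X c)) - int (Poly_Mapping.lookup t (X c)))) =
        int p * (int (Poly_Mapping.lookup t (Z i)) - int (Poly_Mapping.lookup s (Z i)))"
      using assms[rule_format, of "Inl i"] i unfolding lawrence_row_upper[OF i]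
      by (simp add: right_diff_distrib sum_subtractf)
  qed
  then have "xsynd s = xsynd t" by (simp add: xsynd_eq_iff_dvd)
  moreover have "Poly_Mapping.lookup s (X c) + Poly_Mapping.lookup s (Y c) =
      Poly_Mapping.lookup t (X c) + Poly_Mapping.lookup t (Y c)" if c: "c \<in> col_idx" for c
    using assms[rule_format, of "Inr c"] c unfolding lawrence_row_lower[OF c] by simp
  ultimately show ?thesis by (auto simp: lawrence_degree_def)
qed

text \<open>
  The degree does not see the \<open>z\<close>-variables, so it may be computed before or after setting them
  to 1.
\<close>

lemma I_Lambda_in_kernel:
  assumes "f \<in> (I_Lambda p row_idx col_idx D :: (var, 'k::field) mpoly set)"
  shows "Poly_Mapping.keys f \<subseteq> monomials (X ` col_idx \<union> Y ` col_idx)" "regrade lawrence_degree f = 0"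
proof -
  let ?V = "X ` col_idx \<union> Y ` col_idx \<union> Z ` row_idx"
  let ?J = "{f :: (var, 'k) mpoly. Poly_Mapping.keys f \<subseteq> monomials ?V \<and> regrade lawrence_degree f = 0}"
  obtain g where g: "g \<in> lawrence_toric_ideal p row_idx col_idx D" "f = regrade drop_z g"
    using assms unfolding I_Lambda_def psubst_z_to_one by blast
  have "ideal ?J (mpoly_ring ?V)" by (rule ideal_kernel_regrade) (simp add: lawrence_degree_cancel)
  then have "lawrence_toric_ideal p row_idx col_idx D \<subseteq> ?J"
    unfolding lawrence_toric_ideal_def toric_ideal_def
  proof (rule ring.genideal_minimal[OF ring_mpoly_ring], safe)
    fix s t assume st: "s \<in> monomials ?V" "t \<in> monomials ?V" and rows: "\<forall>i\<in>Inl ` row_idx \<union> Inr ` col_idx.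
      (\<Sum>v\<in>?V. lawrence_lifting p D i v * int (Poly_Mapping.lookup s v)) =
      (\<Sum>v\<in>?V. lawrence_lifting p D i v * int (Poly_Mapping.lookup t v))"
    show "regrade lawrence_degree (mon s - mon t :: (var, 'k) mpoly) = 0"
      by (simp add: regrade_diff lawrence_degree_eq_if_rows_eq[OF rows])
    fix x assume "x \<in> Poly_Mapping.keys (mon s - mon t :: (var, 'k) mpoly)"
    then show "x \<in> monomials ?V" using st keys_diff[of "mon s :: (var, 'k) mpoly" "mon t"] by auto
  qed
  then have J: "g \<in> ?J" using g(1) by blast
  then show "regrade lawrence_degree f = 0" by (simp add: g(2) regrade_regrade lawrence_degree_drop_z)
  have "drop_z t \<in> monomials (X ` col_idx \<union> Y ` col_idx)" if t: "t \<in> monomials ?V" for t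
  proof -
    have "v \<in> X ` col_idx \<union> Y ` col_idx" if "v \<in> Poly_Mapping.keys (drop_z t)" for v
      using that t by (cases v) (auto simp: in_keys_iff lookup_drop_z monomials_def subset_iff)
    then show ?thesis by (auto simp: monomials_def)
  qed
  then show "Poly_Mapping.keys f \<subseteq> monomials (X ` col_idx \<union> Y ` col_idx)"
    using J keys_regrade[of drop_z g] unfolding g(2) by blast
qed

text \<open>
  The upper rows evaluated at \<open>s\<close> and \<open>t\<close> differ by multiples \<open>p * q i\<close>.  For each \<open>i\<close>,
  multiplying one of the two monomials by a power of \<open>z\<^sub>i\<close> compensates for this difference; the
  result is a binomial of the toric ideal, from which setting \<open>z\<close> to 1 recovers the given one.
\<close>

lemma binomial_in_I_Lambda:
  assumes st: "s \<in> monomials (X ` col_idx \<union> Y ` col_idx)" "t \<in> monomials (X ` col_idx \<union> Y ` col_idx)"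
    and deg: "lawrence_degree s = lawrence_degree t"
  shows "mon s - mon t \<in> (I_Lambda p row_idx col_idx D :: (var, 'k::field) mpoly set)"
proof -
  let ?V = "X ` col_idx \<union> Y ` col_idx \<union> Z ` row_idx"
  define d where "d i = (\<Sum>c\<in>col_idx. D i c * (int (Poly_Mapping.lookup s (X c)) - int (Poly_Mapping.lookup t (X c))))" for i
  have "\<forall>i\<in>row_idx. int p dvd d i"
    using deg by (auto simp: lawrence_degree_def xsynd_eq_iff_dvd d_def)
  then have "\<exists>q. \<forall>i\<in>row_idx. d i = int p * q i" unfolding dvd_def by (rule bchoice)
  then obtain q where q: "\<And>i. i \<in> row_idx \<Longrightarrow> d i = int p * q i" by blast
  define lift_z where "lift_z w e = w + (\<Sum>i\<in>row_idx. Poly_Mapping.single (Z i) (nat (e i)))"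
    for w :: "var \<Rightarrow>\<^sub>0 nat" and e :: "nat \<times> nat \<Rightarrow> int"
  have Zs: "Poly_Mapping.lookup w (Z i) = 0" if "w \<in> monomials (X ` col_idx \<union> Y ` col_idx)" for w :: "var \<Rightarrow>\<^sub>0 nat" and i
    using that by (auto simp: monomials_def subset_iff in_keys_iff)
  have lookup_lift: "Poly_Mapping.lookup (lift_z w e) (X c) = Poly_Mapping.lookup w (X c)"
    "Poly_Mapping.lookup (lift_z w e) (Y c) = Poly_Mapping.lookup w (Y c)"
    "Poly_Mapping.lookup (lift_z w e) (Z i) = Poly_Mapping.lookup w (Z i) + (if i \<in> row_idx then nat (e i) else 0)" for w e c i
    by (simp_all add: lift_z_def lookup_add lookup_sum lookup_single when_def)
  have drop_lift: "drop_z (lift_z w e) = w" if "w \<in> monomials (X ` col_idx \<union> Y ` col_idx)" for w e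
  proof (rule poly_mapping_eqI)
    fix v show "Poly_Mapping.lookup (drop_z (lift_z w e)) v = Poly_Mapping.lookup w v"
      using Zs[OF that] by (cases v) (simp_all add: lookup_drop_z lookup_lift)
  qed
  have lift_monomials: "lift_z w e \<in> monomials ?V" if "w \<in> monomials (X ` col_idx \<union> Y ` col_idx)" for w e
  proof -
    have "w \<in> monomials ?V" using that by (auto simp: monomials_def)
    moreover have "(\<Sum>i\<in>row_idx. Poly_Mapping.single (Z i) (nat (e i))) \<in> monomials ?V"
      by (rule monomials_sum) (auto simp: monomials_def)
    ultimately show ?thesis by (simp add: lift_z_def)
  qed
  \<comment> \<open>exponents are natural numbers: negative multiples go to \<open>s\<close>, positive ones to \<open>t\<close>\<close>
  let ?s = "lift_z s (\<lambda>i. - q i)" and ?t = "lift_z t q"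
  have rows: "\<forall>i\<in>Inl ` row_idx \<union> Inr ` col_idx.
      (\<Sum>v\<in>?V. lawrence_lifting p D i v * int (Poly_Mapping.lookup ?s v)) =
      (\<Sum>v\<in>?V. lawrence_lifting p D i v * int (Poly_Mapping.lookup ?t v))"
  proof (intro ballI, elim UnE imageE)
    fix j :: "nat \<times> nat + nat \<times> nat" and i assume j: "j = Inl i" and i: "i \<in> row_idx"
    have "(\<Sum>c\<in>col_idx. D i c * int (Poly_Mapping.lookup s (X c))) =
        (\<Sum>c\<in>col_idx. D i c * int (Poly_Mapping.lookup t (X c))) + int p * q i"
      using q[OF i] by (simp add: d_def right_diff_distrib sum_subtractf)
    moreover have "int p * q i + int p * int (nat (- q i)) = int p * int (nat (q i))"
      by (simp flip: distrib_left)
    ultimately show "(\<Sum>v\<in>?V. lawrence_lifting p D j v * int (Poly_Mapping.lookup ?s v)) =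
        (\<Sum>v\<in>?V. lawrence_lifting p D j v * int (Poly_Mapping.lookup ?t v))"
      unfolding j lawrence_row_upper[OF i] using i Zs[OF st(1)] Zs[OF st(2)] by (simp add: lookup_lift)
  next
    fix j :: "nat \<times> nat + nat \<times> nat" and c assume j: "j = Inr c" and c: "c \<in> col_idx"
    have "Poly_Mapping.lookup s (X c) + Poly_Mapping.lookup s (Y c) =
        Poly_Mapping.lookup t (X c) + Poly_Mapping.lookup t (Y c)"
      using deg c unfolding lawrence_degree_def prod.inject fun_eq_iff by metis
    then show "(\<Sum>v\<in>?V. lawrence_lifting p D j v * int (Poly_Mapping.lookup ?s v)) =
        (\<Sum>v\<in>?V. lawrence_lifting p D j v * int (Poly_Mapping.lookup ?t v))"
      unfolding j lawrence_row_lower[OF c] by (simp add: lookup_lift flip: of_nat_add)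
  qed
  have "(mon ?s - mon ?t :: (var, 'k) mpoly) \<in> lawrence_toric_ideal p row_idx col_idx D"
  proof -
    let ?S = "{mon u - mon v :: (var, 'k) mpoly | u v. u \<in> monomials ?V \<and> v \<in> monomials ?V \<and>
      (\<forall>i\<in>Inl ` row_idx \<union> Inr ` col_idx. (\<Sum>c\<in>?V. lawrence_lifting p D i c * int (Poly_Mapping.lookup u c)) =
             (\<Sum>c\<in>?V. lawrence_lifting p D i c * int (Poly_Mapping.lookup v c)))}"
    have "Poly_Mapping.keys (mon u - mon v :: (var, 'k) mpoly) \<subseteq> monomials ?V"
      if "u \<in> monomials ?V" "v \<in> monomials ?V" for u v
      using that keys_diff[of "mon u :: (var, 'k) mpoly" "mon v"] by auto
    then have "?S \<subseteq> carrier (mpoly_ring ?V)" by auto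
    then have "?S \<subseteq> lawrence_toric_ideal p row_idx col_idx D"
      unfolding lawrence_toric_ideal_def toric_ideal_def by (rule ring.genideal_self[OF ring_mpoly_ring])
    moreover have "mon ?s - mon ?t \<in> ?S"
      using rows lift_monomials st by blast
    ultimately show ?thesis by blast
  qed
  moreover have "psubst z_to_one (mon ?s - mon ?t) = (mon s - mon t :: (var, 'k) mpoly)"
    unfolding psubst_z_to_one by (simp add: regrade_diff drop_lift st mon_def)
  ultimately show ?thesis unfolding I_Lambda_def by (metis image_eqI)
qed

end

section \<open>Graver basis and Lawrence binomials\<close>

definition lawrence_exp :: "(nat \<times> nat \<Rightarrow>\<^sub>0 nat) \<Rightarrow> (nat \<times> nat \<Rightarrow>\<^sub>0 nat) \<Rightarrow> (var \<Rightarrow>\<^sub>0 nat)" where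
  "lawrence_exp u v = rename_exp X u + rename_exp Y v"

lemma xpow_ypow: "xpow u * ypow v = (mon (lawrence_exp u v) :: (var, 'k::field) mpoly)"
  by (simp add: xpow_def ypow_def lawrence_exp_def mon_add)

lemma lookup_lawrence_exp [simp]:
  "Poly_Mapping.lookup (lawrence_exp u v) (X c) = Poly_Mapping.lookup u c"
  "Poly_Mapping.lookup (lawrence_exp u v) (Y c) = Poly_Mapping.lookup v c"
  by (simp_all add: lawrence_exp_def lookup_add)

lemma lawrence_exp_inject [simp]: "lawrence_exp u v = lawrence_exp u' v' \<longleftrightarrow> u = u' \<and> v = v'"
  by (metis lookup_lawrence_exp poly_mapping_eqI)

lemma lawrence_exp_add: "lawrence_exp (u + u') (v + v') = lawrence_exp u v + lawrence_exp u' v'"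
  by (simp add: lawrence_exp_def rename_exp_add ac_simps)

lemma lawrence_exp_in_monomials:
  "Poly_Mapping.keys u \<subseteq> N \<Longrightarrow> Poly_Mapping.keys v \<subseteq> N \<Longrightarrow> lawrence_exp u v \<in> monomials (X ` N \<union> Y ` N)"
  by (simp add: lawrence_exp_def rename_in_monomials_XY)

lemma lawrence_exp_split:
  "t \<in> monomials (X ` N \<union> Y ` N) \<Longrightarrow> t = lawrence_exp (xpart t) (ypart t)"
  unfolding lawrence_exp_def by (rule monomials_XY_split(3))

lemma rename_X_factorD:
  assumes "rename_exp X u = s + t" "Poly_Mapping.keys u \<subseteq> N"
  obtains s' t' where "s = rename_exp X s'" "t = rename_exp X t'" "u = s' + t'"
    "Poly_Mapping.keys s' \<subseteq> N" "Poly_Mapping.keys t' \<subseteq> N"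
proof -
  have "s + t \<in> monomials (X ` N)" using assms by (metis rename_X_in_monomials)
  then have "s \<in> monomials (X ` N)" "t \<in> monomials (X ` N)" by simp_all
  then obtain s' t' where st: "s = rename_exp X s'" "t = rename_exp X t'"
    "Poly_Mapping.keys s' \<subseteq> N" "Poly_Mapping.keys t' \<subseteq> N"
    using monomials_X_rename by metis
  then have "u = s' + t'" using assms(1) by (metis rename_exp_add rename_exp_inject)
  then show thesis using that st by blast
qed

locale code_groebner_basis = code_with_check_matrix p r n k \<alpha> b C H D
  for p r n k :: nat and \<alpha> :: "'f::{field, finite}" and b :: "nat \<Rightarrow> 'f" and C :: "'f vec set"
    and H :: "'f mat" and D :: "nat \<times> nat \<Rightarrow> nat \<times> nat \<Rightarrow> int" +
  fixes R :: "(var \<Rightarrow>\<^sub>0 nat) rel" and G :: "(var, 'k::field) mpoly set"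
  assumes monomial_order: "monomial_order (X ` col_idx \<union> Y ` col_idx) R"
    and reduced_basis: "reduced_groebner_basis (X ` col_idx \<union> Y ` col_idx) R (I_Lambda p row_idx col_idx D) G"
begin

sublocale gb: binomial_groebner_basis "X ` col_idx \<union> Y ` col_idx" R
  "I_Lambda p row_idx col_idx D" G lawrence_degree
  using monomial_order reduced_basis I_Lambda_in_kernel binomial_in_I_Lambda
  by unfold_locales

lemma lawrence_degree_swap_iff:
  "lawrence_degree (lawrence_exp u v) = lawrence_degree (lawrence_exp v u) \<longleftrightarrow>
    xsynd (rename_exp X u) = xsynd (rename_exp X v)"
proof -
  have "xsynd (lawrence_exp u v) = xsynd (rename_exp X u)" for u v
    by (simp add: lawrence_exp_def)
  moreover have "Poly_Mapping.lookup (lawrence_exp u v) (X c) + Poly_Mapping.lookup (lawrence_exp u v) (Y c) =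
      Poly_Mapping.lookup (lawrence_exp v u) (X c) + Poly_Mapping.lookup (lawrence_exp v u) (Y c)" for c
    by simp
  ultimately show ?thesis by (simp only: lawrence_degree_def prod.inject simp_thms)
qed

text \<open>
  A proper divisor \<open>(u', v')\<close> of the pair \<open>(u, v)\<close> gives a proper divisor
  \<open>x\<^sup>u\<^sup>' y\<^sup>v\<^sup>' - x\<^sup>v\<^sup>' y\<^sup>u\<^sup>'\<close> of the Lawrence binomial, which contradicts that elements of \<open>G\<close> are
  primitive.  A common factor of \<open>x\<^sup>u\<close> and \<open>x\<^sup>v\<close> can be cancelled without changing equality of
  syndromes, so the same argument shows that they are relatively prime.
\<close>

lemma graver_if_in_G:
  assumes keys: "Poly_Mapping.keys u \<subseteq> col_idx" "Poly_Mapping.keys v \<subseteq> col_idx"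
    and G: "xpow u * ypow v - xpow v * ypow u \<in> G"
  shows "xpow u - xpow v \<in> graver_basis (I_plus \<alpha> n C :: (var, 'k) mpoly set)"
proof -
  have G': "mon (lawrence_exp u v) - mon (lawrence_exp v u) \<in> G" using G by (simp add: xpow_ypow)
  have "u \<noteq> v" using gb.G_primitive(3)[OF G'] by auto
  then have neq: "rename_exp X u \<noteq> rename_exp X v" by simp
  have synd: "xsynd (rename_exp X u) = xsynd (rename_exp X v)"
    using gb.G_primitive(4)[OF G'] by (simp add: lawrence_degree_swap_iff)
  have mem: "(mon (rename_exp X u) - mon (rename_exp X v) :: (var, 'k) mpoly) \<in> I_plus \<alpha> n C"
    using binomial_in_I_plus_iff[OF neq] keys synd by simp
  have minimal: "u' = u \<and> v' = v"
    if "u' \<noteq> v'" "xsynd (rename_exp X u') = xsynd (rename_exp X v')" "u = u' + s" "v = v' + t" for u' v' s t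
  proof -
    have "lawrence_exp u' v' = lawrence_exp u v \<and> lawrence_exp v' u' = lawrence_exp v u"
      by (rule gb.G_primitive(5)[OF G'])
        (use that in \<open>simp_all add: lawrence_degree_swap_iff lawrence_exp_add\<close>)
    then show ?thesis by simp
  qed
  have pure: "pure_pair TYPE('k) (rename_exp X u) (rename_exp X v)"
    unfolding pure_pair_def mon_dvd_mon_iff
  proof (intro conjI allI impI)
    show "(mon (rename_exp X u) :: (var, 'k) mpoly) \<noteq> mon (rename_exp X v)" using neq by simp
    fix w assume "\<exists>t. rename_exp X u = w + t" "\<exists>t. rename_exp X v = w + t"
    then obtain s t where st: "rename_exp X u = w + s" "rename_exp X v = w + t" by blast
    then obtain w' s' where w: "w = rename_exp X w'" "s = rename_exp X s'" "u = w' + s'"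
      using rename_X_factorD[OF _ keys(1)] by metis
    obtain t' where t: "t = rename_exp X t'" "v = w' + t'"
      using rename_X_factorD[OF st(2) keys(2)] w(1) by (metis rename_exp_inject)
    have "xsynd (rename_exp X s') = xsynd (rename_exp X t')"
      using synd by (simp add: w t rename_exp_add xsynd_add fun_eq_iff del: xsynd_rename)
    then have "s' = u \<and> t' = v"
      using \<open>u \<noteq> v\<close> w t by (intro minimal[of s' t' w' w']) (auto simp: add.commute)
    then have "w' = 0" using w(3) by simp
    then show "(mon w :: (var, 'k) mpoly) = 1" by (simp add: w(1))
  qed
  have "\<not> (\<exists>u' v'. pure_pair TYPE('k) u' v' \<and> (mon u' - mon v' :: (var, 'k) mpoly) \<in> I_plus \<alpha> n C \<and>
      (mon u' - mon v' :: (var, 'k) mpoly) \<noteq> mon (rename_exp X u) - mon (rename_exp X v) \<and>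
      (mon u' :: (var, 'k) mpoly) dvd mon (rename_exp X u) \<and> (mon v' :: (var, 'k) mpoly) dvd mon (rename_exp X v))"
    unfolding mon_dvd_mon_iff
  proof (rule notI, elim exE conjE)
    fix a b s t
    assume pure: "pure_pair TYPE('k) a b" and mem: "(mon a - mon b :: (var, 'k) mpoly) \<in> I_plus \<alpha> n C"
      and ne: "(mon a - mon b :: (var, 'k) mpoly) \<noteq> mon (rename_exp X u) - mon (rename_exp X v)"
      and st: "rename_exp X u = a + s" "rename_exp X v = b + t"
    obtain a' s' where a: "a = rename_exp X a'" "u = a' + s'" using rename_X_factorD[OF st(1) keys(1)] by metis
    obtain b' t' where b: "b = rename_exp X b'" "v = b' + t'" using rename_X_factorD[OF st(2) keys(2)] by metis
    have "a \<noteq> b" using pure by (simp add: pure_pair_def)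
    then have "xsynd a = xsynd b" using mem binomial_in_I_plus_iff by blast
    then have "a' = u \<and> b' = v" using \<open>a \<noteq> b\<close> a b by (intro minimal[of a' b' s' t']) auto
    then show False using ne a b by simp
  qed
  then show ?thesis unfolding graver_basis_def xpow_def using pure mem by blast
qed

text \<open>
  The larger monomial \<open>x\<^sup>u y\<^sup>v\<close> is divisible by the leading monomial \<open>T\<close> of some \<open>h = T - s\<close> in
  \<open>G\<close>.  As \<open>h\<close> is primitive, \<open>T\<close> and \<open>s\<close> are relatively prime; for every \<open>c\<close> they have the same
  total degree in \<open>x\<^sub>c, y\<^sub>c\<close>, so \<open>s\<close> arises from \<open>T\<close> by exchanging \<open>x\<close> and \<open>y\<close>.  Hence \<open>h\<close> is
  itself a Lawrence binomial of a pair dividing \<open>(u, v)\<close>, and minimality identifies the two.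
\<close>

lemma larger_lawrence_binomial_in_G:
  assumes keys: "Poly_Mapping.keys u \<subseteq> col_idx" "Poly_Mapping.keys v \<subseteq> col_idx"
    and neq: "u \<noteq> v" and synd: "xsynd (rename_exp X u) = xsynd (rename_exp X v)"
    and minimal: "\<And>u' v' s t. u' \<noteq> v' \<Longrightarrow> xsynd (rename_exp X u') = xsynd (rename_exp X v') \<Longrightarrow>
      (\<And>c. Poly_Mapping.lookup u' c = 0 \<or> Poly_Mapping.lookup v' c = 0) \<Longrightarrow>
      u = u' + s \<Longrightarrow> v = v' + t \<Longrightarrow> u' = u \<and> v' = v"
    and larger: "(lawrence_exp v u, lawrence_exp u v) \<in> R"
  shows "xpow u * ypow v - xpow v * ypow u \<in> G"
proof -
  obtain h w where h: "h \<in> G" and w: "lawrence_exp u v = lead_exp R h + w"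
    using gb.larger_monomial_divisible[OF _ _ _ _ larger] neq synd lawrence_exp_in_monomials keys
    by (metis lawrence_degree_swap_iff lawrence_exp_inject)
  define T where "T = lead_exp R h"
  obtain s where s: "h = mon T - mon s" unfolding T_def by (rule gb.G_binomial[OF h])
  have hG: "mon T - mon s \<in> G" using h s by simp
  note prim = gb.G_primitive[OF hG]
  \<comment> \<open>a common variable could be cancelled, which contradicts primitivity of \<open>h\<close>\<close>
  have coprime: "Poly_Mapping.lookup T x = 0 \<or> Poly_Mapping.lookup s x = 0" for x
  proof (rule ccontr)
    define e where "e = Poly_Mapping.single x (1::nat)"
    assume "\<not> ?thesis"
    then have eq: "T = (T - e) + e" "s = (s - e) + e"
      by (auto intro!: poly_mapping_eqI simp: e_def lookup_add lookup_minus lookup_single when_def)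
    have "lawrence_degree (T - e) = lawrence_degree (s - e)"
      using prim(4) eq lawrence_degree_cancel[of e "T - e" "s - e"] by (simp add: add.commute)
    moreover have "T - e \<noteq> s - e" using prim(3) eq by metis
    ultimately have "T - e = T" using prim(5)[of "T - e" "s - e" e e] eq by blast
    then have "e = 0" using eq(1) by (metis add_cancel_right_right)
    then have "Poly_Mapping.lookup e x = 0" by simp
    then show False by (simp add: e_def)
  qed
  have degree: "Poly_Mapping.lookup T (X c) + Poly_Mapping.lookup T (Y c) =
      Poly_Mapping.lookup s (X c) + Poly_Mapping.lookup s (Y c)" for c
  proof (cases "c \<in> col_idx")
    case True
    have "fst (lawrence_degree T) c = fst (lawrence_degree s) c" using prim(4) by simp
    then show ?thesis using True by (simp add: lawrence_degree_def)
  next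
    case False
    then have "Poly_Mapping.lookup a (X c) = 0 \<and> Poly_Mapping.lookup a (Y c) = 0"
      if "a \<in> monomials (X ` col_idx \<union> Y ` col_idx)" for a :: "var \<Rightarrow>\<^sub>0 nat"
      using that by (auto simp: monomials_def subset_iff in_keys_iff)
    then show ?thesis using prim(1,2) by simp
  qed
  define x y where "x = xpart T" and "y = ypart T"
  have swap: "Poly_Mapping.lookup s (X c) = Poly_Mapping.lookup T (Y c)"
    "Poly_Mapping.lookup s (Y c) = Poly_Mapping.lookup T (X c)" for c
    using degree[of c] coprime[of "X c"] coprime[of "Y c"] by auto
  have T: "T = lawrence_exp x y" unfolding x_def y_def by (rule lawrence_exp_split[OF prim(1)])
  have "xpart s = y" "ypart s = x" by (auto intro!: poly_mapping_eqI simp: x_def y_def swap)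
  then have s': "s = lawrence_exp y x" using lawrence_exp_split[OF prim(2)] by simp
  have "x \<noteq> y" using prim(3) T s' by auto
  moreover have "xsynd (rename_exp X x) = xsynd (rename_exp X y)"
    using prim(4) unfolding T s' by (simp only: lawrence_degree_swap_iff)
  moreover have "Poly_Mapping.lookup x c = 0 \<or> Poly_Mapping.lookup y c = 0" for c
    using coprime[of "X c"] swap[of c] by (simp add: x_def y_def)
  moreover have "u = x + xpart w"
  proof (rule poly_mapping_eqI)
    fix c show "Poly_Mapping.lookup u c = Poly_Mapping.lookup (x + xpart w) c"
      using arg_cong[OF w, of "\<lambda>t. Poly_Mapping.lookup t (X c)"] by (simp add: lookup_add x_def T_def)
  qed
  moreover have "v = y + ypart w"
  proof (rule poly_mapping_eqI)
    fix c show "Poly_Mapping.lookup v c = Poly_Mapping.lookup (y + ypart w) c"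
      using arg_cong[OF w, of "\<lambda>t. Poly_Mapping.lookup t (Y c)"] by (simp add: lookup_add y_def T_def)
  qed
  ultimately have "x = u \<and> y = v" by (rule minimal)
  then show ?thesis using hG by (simp add: xpow_ypow T s')
qed

text \<open>
  Which of the two signs occurs depends on which monomial of the Lawrence binomial is larger,
  because elements of a reduced Groebner basis have leading coefficient 1.
\<close>

lemma in_G_if_graver:
  assumes "f \<in> graver_basis (I_plus \<alpha> n C :: (var, 'k) mpoly set)"
  obtains u v where "f = xpow u - xpow v" "Poly_Mapping.keys u \<subseteq> col_idx" "Poly_Mapping.keys v \<subseteq> col_idx"
    "xpow u * ypow v - xpow v * ypow u \<in> G \<or> xpow v * ypow u - xpow u * ypow v \<in> G"
proof -
  obtain a b where f: "f = mon a - mon b" and pure: "pure_pair TYPE('k) a b"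
    and mem: "(mon a - mon b :: (var, 'k) mpoly) \<in> I_plus \<alpha> n C"
    and prim: "\<not> (\<exists>u' v'. pure_pair TYPE('k) u' v' \<and> (mon u' - mon v' :: (var, 'k) mpoly) \<in> I_plus \<alpha> n C \<and>
          (mon u' - mon v' :: (var, 'k) mpoly) \<noteq> mon a - mon b \<and>
          (mon u' :: (var, 'k) mpoly) dvd mon a \<and> (mon v' :: (var, 'k) mpoly) dvd mon b)"
    using assms unfolding graver_basis_def by blast
  have "a \<noteq> b" using pure by (simp add: pure_pair_def)
  then have ab: "a \<in> monomials (X ` col_idx)" "b \<in> monomials (X ` col_idx)" "xsynd a = xsynd b"
    using mem binomial_in_I_plus_iff by blast+
  obtain u where u: "Poly_Mapping.keys u \<subseteq> col_idx" "a = rename_exp X u" by (rule monomials_X_rename[OF ab(1)])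
  obtain v where v: "Poly_Mapping.keys v \<subseteq> col_idx" "b = rename_exp X v" by (rule monomials_X_rename[OF ab(2)])
  have "u \<noteq> v" using \<open>a \<noteq> b\<close> u v by auto
  have synd: "xsynd (rename_exp X u) = xsynd (rename_exp X v)" using ab(3) u v by simp
  have minimal: "u' = u \<and> v' = v"
    if ne: "u' \<noteq> v'" and eq: "xsynd (rename_exp X u') = xsynd (rename_exp X v')"
      and coprime: "\<And>c. Poly_Mapping.lookup u' c = 0 \<or> Poly_Mapping.lookup v' c = 0"
      and st: "u = u' + s" "v = v' + t" for u' v' s t
  proof -
    have ne': "rename_exp X u' \<noteq> rename_exp X v'" using ne by simp
    have dvd: "\<exists>s. a = rename_exp X u' + s" "\<exists>t. b = rename_exp X v' + t"
      using u v st by (auto simp: rename_exp_add)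
    have "pure_pair TYPE('k) (rename_exp X u') (rename_exp X v')"
      unfolding pure_pair_def mon_dvd_mon_iff
    proof (intro conjI allI impI)
      show "(mon (rename_exp X u') :: (var, 'k) mpoly) \<noteq> mon (rename_exp X v')" using ne by simp
      fix w assume "\<exists>t. rename_exp X u' = w + t" "\<exists>t. rename_exp X v' = w + t"
      then obtain s t where w: "rename_exp X u' = w + s" "rename_exp X v' = w + t" by blast
      have "Poly_Mapping.lookup w x = 0" for x
      proof -
        have eqs: "Poly_Mapping.lookup (rename_exp X u') x = Poly_Mapping.lookup w x + Poly_Mapping.lookup s x"
          "Poly_Mapping.lookup (rename_exp X v') x = Poly_Mapping.lookup w x + Poly_Mapping.lookup t x"
          by (simp_all add: w lookup_add)
        show ?thesis
        proof (cases x)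
          case (X c)
          then show ?thesis using eqs coprime[of c] by auto
        qed (use eqs in simp_all)
      qed
      then have "w = 0" by (intro poly_mapping_eqI) simp
      then show "(mon w :: (var, 'k) mpoly) = 1" by simp
    qed
    moreover have "rename_exp X u' \<in> monomials (X ` col_idx)" "rename_exp X v' \<in> monomials (X ` col_idx)"
      using ab dvd by auto
    then have "(mon (rename_exp X u') - mon (rename_exp X v') :: (var, 'k) mpoly) \<in> I_plus \<alpha> n C"
      using binomial_in_I_plus_iff[OF ne'] eq by blast
    ultimately have same: "(mon (rename_exp X u') - mon (rename_exp X v') :: (var, 'k) mpoly) = mon a - mon b"
      using prim dvd unfolding mon_dvd_mon_iff by blast
    then consider "u' = u" "v' = v" | (swap) "u' = v" "v' = u"
      using mon_diff_eq_mon_diffD[OF same ne'] u v by auto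
    then show ?thesis
    proof cases
      case swap
      \<comment> \<open>\<open>u\<close> and \<open>v\<close> divide each other, so they coincide\<close>
      then have "u = v + s" "v = u + t" using st by simp_all
      then have "u = u + (t + s)" by (metis add.assoc)
      then have "t + s = 0" by (metis add_cancel_right_right)
      then have "Poly_Mapping.lookup t c + Poly_Mapping.lookup s c = 0" for c
        by (metis lookup_add lookup_zero)
      then have "s = 0" by (intro poly_mapping_eqI) simp
      then show ?thesis using swap st(1) \<open>u \<noteq> v\<close> by simp
    qed simp
  qed
  have "xpow u * ypow v - xpow v * ypow u \<in> G \<or> xpow v * ypow u - xpow u * ypow v \<in> G"
  proof -
    consider "(lawrence_exp v u, lawrence_exp u v) \<in> R" | "(lawrence_exp u v, lawrence_exp v u) \<in> R"
      using gb.order_total lawrence_exp_in_monomials u v by blast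
    then show ?thesis
    proof cases
      case 1
      have "xpow u * ypow v - xpow v * ypow u \<in> G"
        by (rule larger_lawrence_binomial_in_G[OF u(1) v(1) \<open>u \<noteq> v\<close> synd _ 1]) (rule minimal)
      then show ?thesis by blast
    next
      case 2
      have "xpow v * ypow u - xpow u * ypow v \<in> G"
      proof (rule larger_lawrence_binomial_in_G[OF v(1) u(1) \<open>u \<noteq> v\<close>[symmetric] synd[symmetric] _ 2])
        fix v' u' s t :: "nat \<times> nat \<Rightarrow>\<^sub>0 nat"
        assume ne: "v' \<noteq> u'" and eq: "xsynd (rename_exp X v') = xsynd (rename_exp X u')"
          and coprime: "\<And>c. Poly_Mapping.lookup v' c = 0 \<or> Poly_Mapping.lookup u' c = 0"
          and st: "v = v' + s" "u = u' + t"
        have "Poly_Mapping.lookup u' c = 0 \<or> Poly_Mapping.lookup v' c = 0" for c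
          by (subst disj_commute) (rule coprime)
        from minimal[OF ne[symmetric] eq[symmetric] this st(2,1)]
        show "v' = v \<and> u' = u" by blast
      qed
      then show ?thesis by blast
    qed
  qed
  then show thesis using that[of u v] f u v by (simp add: xpow_def)
qed

end

lemma up_to_sign_eqI:
  fixes A B :: "'a::ab_group_add set"
  assumes "\<And>f. f \<in> A \<Longrightarrow> f \<in> B \<or> - f \<in> B" "B \<subseteq> A"
  shows "up_to_sign A = up_to_sign B"
proof
  show "up_to_sign A \<subseteq> up_to_sign B"
  proof
    fix s assume "s \<in> up_to_sign A"
    then obtain f where f: "f \<in> A" "s = {f, - f}" by (auto simp: up_to_sign_def)
    then consider "f \<in> B" | "- f \<in> B" using assms(1) by blast
    then show "s \<in> up_to_sign B"
      using f by cases (auto simp: up_to_sign_def intro: rev_image_eqI)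
  qed
qed (use assms(2) in \<open>auto simp: up_to_sign_def\<close>)

theorem proposition4p5:
  fixes p r n k :: nat
    and \<alpha> :: "'f::{field, finite}"
    and b :: "nat \<Rightarrow> 'f"
    and C :: "'f vec set"
    and H :: "'f mat"
    and D :: "nat \<times> nat \<Rightarrow> nat \<times> nat \<Rightarrow> int"
    and R :: "(var \<Rightarrow>\<^sub>0 nat) rel"
    and G :: "(var, 'k::field) mpoly set"
  defines "row_idx \<equiv> {..<n - k} \<times> {..<r}"
    and "col_idx \<equiv> block_idx TYPE('f) n"
  assumes "prime p" and "CARD('f) = p ^ r"
    and "primitive_element \<alpha>"
    and "prime_field_basis r b"
    and "linear_code n k C"
    and "parity_check_matrix n k C H"
    and "integer_lift row_idx col_idx (H_plus_e \<alpha> r b H) D"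
    and "monomial_order (X ` col_idx \<union> Y ` col_idx) R"
    and "reduced_groebner_basis (X ` col_idx \<union> Y ` col_idx) R (I_Lambda p row_idx col_idx D) G"
  shows "up_to_sign (graver_basis (I_plus \<alpha> n C :: (var, 'k) mpoly set)) =
    up_to_sign {xpow u - xpow v | u v.
      Poly_Mapping.keys u \<subseteq> col_idx \<and> Poly_Mapping.keys v \<subseteq> col_idx \<and>
      xpow u * ypow v - xpow v * ypow u \<in> G}"
proof -
  interpret code: code_with_check_matrix p r n k \<alpha> b C H D
    using assms(3-) unfolding row_idx_def col_idx_def by unfold_locales
  have idx: "col_idx = code.col_idx" "row_idx = code.row_idx"
    by (simp_all add: col_idx_def row_idx_def code.col_idx_def code.row_idx_def)
  interpret code_groebner_basis p r n k \<alpha> b C H D R G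
    using assms(10,11) unfolding idx by unfold_locales
  show ?thesis (is "_ = up_to_sign ?B")
  proof (rule up_to_sign_eqI)
    fix f :: "(var, 'k) mpoly" assume "f \<in> graver_basis (I_plus \<alpha> n C)"
    then obtain u v where "f = xpow u - xpow v" "Poly_Mapping.keys u \<subseteq> code.col_idx" "Poly_Mapping.keys v \<subseteq> code.col_idx"
      "xpow u * ypow v - xpow v * ypow u \<in> G \<or> xpow v * ypow u - xpow u * ypow v \<in> G"
      by (rule in_G_if_graver)
    moreover from this(1) have "- f = xpow v - xpow u" by simp
    ultimately show "f \<in> ?B \<or> - f \<in> ?B" unfolding idx by blast
  next
    show "?B \<subseteq> graver_basis (I_plus \<alpha> n C)"
      unfolding idx using graver_if_in_G by blast
  qed
qed

end
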